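(* Let $x$ be a Gaussian random variable taking values in $\mathbb{R}^n$ with zero mean and given covariance matrix $X$. Let $$\begin{bmatrix} Q_0 & S_0\\ S_0^T & R_0\end{bmatrix}\in \mathbb{S}^{m+n}_{+},\quad R_0\in\mathbb{S}^m_{++},$$ and, for $j=1,\dots,M$, $$\begin{bmatrix} Q_j & S_j\\ S_j^T & R_j\end{bmatrix}\in \mathbb{S}^{m+n},\quad R_j\in\mathbb{S}^m_{+},$$ and let $\gamma_1,\dots,\gamma_M\in\mathbb{R}$. Assume that the optimization problem $$\min_{\mu\in\mathcal{C}}\ \mathbf{E}\begin{bmatrix} x\\ \mu(x)\end{bmatrix}^T\begin{bmatrix} Q_0 & S_0\\ S_0^T & R_0\end{bmatrix}\begin{bmatrix} x\\ \mu(x)\end{bmatrix}$$ $$\text{subject to}\quad \mathbf{E}\begin{bmatrix} x\\ \mu(x)\end{bmatrix}^T\begin{bmatrix} Q_j & S_j\\ S_j^T & R_j\end{bmatrix}\begin{bmatrix} x\\ \mu(x)\end{bmatrix}\le\gamma_j,\qquad j=1,\dots,M,$$ is feasible. Then linear decisions are optimal: there is a matrix $K=K(X)\in\mathbb{K}$ such that $\mu(x)=K(X)x$ is an optimal solution of this problem (over all $\mu\in\mathcal{C}$, linear or nonlinear).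
   Context: $\mathbb{S}^k$, $\mathbb{S}^k_{+}$, $\mathbb{S}^k_{++}$ denote the sets of real symmetric, symmetric positive semidefinite and symmetric positive definite $k\times k$ matrices. In each block matrix, $Q_j\in\mathbb{R}^{n\times n}$, $S_j\in\mathbb{R}^{n\times m}$, $R_j\in\mathbb{R}^{m\times m}$. There are $N$ decision makers. Fix positive integers $p_1,\dots,p_N$ and $m_1,\dots,m_N$ with $\sum_i p_i=n$ and $\sum_i m_i=m$, and partition $x=(x_1,\dots,x_N)$ with $x_i\in\mathbb{R}^{p_i}$. $\mathcal{C}$ is the set of (measurable) functions $\mu:\mathbb{R}^n\to\mathbb{R}^m$ of the form $\mu(x)=(\mu_1(x_1)^T,\mu_2(x_2)^T,\dots,\mu_N(x_N)^T)^T$ with $\mu_i:\mathbb{R}^{p_i}\to\mathbb{R}^{m_i}$; that is, decision maker $i$ sees only $x_i$. $\mathbb{K}$ is the set of block-diagonal matrices $K=\mathrm{diag}(K_1,\dots,K_N)$ with $K_i\in\mathbb{R}^{m_i\times p_i}$, so that $x\mapsto Kx$ with $K\in\mathbb{K}$ are exactly the linear elements of $\mathcal{C}$. The value of the minimization problem is taken to be infinite if no admissible decision satisfies the constraints; feasible means that there is a $\mu\in\mathcal{C}$ satisfying all constraints, with finite objective value. *)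

theory Defs
  imports "HOL-Probability.Probability"
begin

definition sym_mats :: "(real^'k^'k) set" where
  "sym_mats = {A. transpose A = A}"

definition psd_mats :: "(real^'k^'k) set" where
  "psd_mats = {A \<in> sym_mats. \<forall>v. 0 \<le> v \<bullet> (A *v v)}"

definition pd_mats :: "(real^'k^'k) set" where
  "pd_mats = {A \<in> sym_mats. \<forall>v. v \<noteq> 0 \<longrightarrow> 0 < v \<bullet> (A *v v)}"

definition stack :: "real^'n \<Rightarrow> real^'m \<Rightarrow> real^('n + 'm)" where
  "stack x u = (\<chi> k. case k of Inl a \<Rightarrow> x $ a | Inr b \<Rightarrow> u $ b)"

definition sym_block :: "real^'n^'n \<Rightarrow> real^'m^'n \<Rightarrow> real^'m^'m \<Rightarrow> real^('n + 'm)^('n + 'm)" where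
  "sym_block Q S R = (\<chi> k l.
     case k of
       Inl a \<Rightarrow> (case l of Inl a' \<Rightarrow> Q $ a $ a' | Inr b' \<Rightarrow> S $ a $ b')
     | Inr b \<Rightarrow> (case l of Inl a' \<Rightarrow> transpose S $ b $ a' | Inr b' \<Rightarrow> R $ b $ b'))"

text \<open>
  The decision makers are the elements of a finite type \<open>'d\<close>, so \<open>N = CARD('d)\<close>. The partitions
  \<open>x = (x\<^sub>1, \<dots>, x\<^sub>N)\<close> and \<open>u = (u\<^sub>1, \<dots>, u\<^sub>N)\<close> are given by maps \<open>bx :: 'n \<Rightarrow> 'd\<close> and
  \<open>bu :: 'm \<Rightarrow> 'd\<close> that send a coordinate to the decision maker owning it: \<open>p\<^sub>i = card (block bx i)\<close>
  and \<open>m\<^sub>i = card (block bu i)\<close>, which automatically add up to \<open>CARD('n)\<close> and \<open>CARD('m)\<close>. All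
  \<open>p\<^sub>i\<close> and all \<open>m\<^sub>i\<close> are positive iff \<open>bx\<close> and \<open>bu\<close> are surjective. The subvector \<open>x\<^sub>i\<close> is an
  element of the product space over \<open>block bx i\<close>, which plays the role of \<open>p\<^sub>i\<close>-dimensional
  Euclidean space.
\<close>

definition block :: "('k \<Rightarrow> 'd) \<Rightarrow> 'd \<Rightarrow> 'k set" where
  "block b i = {k. b k = i}"

definition subvec :: "('k::finite \<Rightarrow> 'd) \<Rightarrow> 'd \<Rightarrow> real^'k \<Rightarrow> 'k \<Rightarrow> real" where
  "subvec b i x = restrict (\<lambda>k. x $ k) (block b i)"

definition block_space :: "('k \<Rightarrow> 'd) \<Rightarrow> 'd \<Rightarrow> ('k \<Rightarrow> real) measure" where
  "block_space b i = (\<Pi>\<^sub>M k\<in>block b i. borel)"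

definition decisions :: "('n::finite \<Rightarrow> 'd) \<Rightarrow> ('m::finite \<Rightarrow> 'd) \<Rightarrow> (real^'n \<Rightarrow> real^'m) set" where
  "decisions bx bu = {\<mu>. \<exists>\<nu>. \<forall>i. \<nu> i \<in> block_space bx i \<rightarrow>\<^sub>M block_space bu i \<and>
     (\<forall>x. subvec bu i (\<mu> x) = \<nu> i (subvec bx i x))}"

definition block_diag :: "('n::finite \<Rightarrow> 'd) \<Rightarrow> ('m::finite \<Rightarrow> 'd) \<Rightarrow> (real^'n^'m) set" where
  "block_diag bx bu = {K. \<forall>k l. bu k \<noteq> bx l \<longrightarrow> K $ k $ l = 0}"

text \<open>
  Every linear functional of the vector is normally distributed. The almost surely constant case is
  the normal distribution with variance 0; it makes singular covariance matrices possible.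
\<close>

definition gaussian_vector :: "'a measure \<Rightarrow> ('a \<Rightarrow> real^'n) \<Rightarrow> bool" where
  "gaussian_vector P x \<longleftrightarrow> x \<in> borel_measurable P \<and>
     (\<forall>a. (\<exists>c. AE \<omega> in P. a \<bullet> x \<omega> = c) \<or>
          (\<exists>c \<sigma>. \<sigma> > 0 \<and> distributed P lborel (\<lambda>\<omega>. a \<bullet> x \<omega>) (normal_density c \<sigma>)))"

definition covariance_matrix :: "'a measure \<Rightarrow> ('a \<Rightarrow> real^'n) \<Rightarrow> real^'n^'n" where
  "covariance_matrix P x = (\<chi> k l. \<integral>\<omega>. (x \<omega> - integral\<^sup>L P x) $ k * (x \<omega> - integral\<^sup>L P x) $ l \<partial>P)"

text \<open>
  Expectation with values in the extended reals. It is the Lebesgue expectation whenever the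
  positive or the negative part has a finite integral. Otherwise the expectation is undefined and
  the value is \<open>\<infinity>\<close>, since \<open>\<infinity> - \<infinity> = \<infinity>\<close> on \<open>ereal\<close>; a constraint with an undefined
  left-hand side is therefore violated.
\<close>

definition ext_expectation :: "'a measure \<Rightarrow> ('a \<Rightarrow> real) \<Rightarrow> ereal" where
  "ext_expectation P f =
     enn2ereal (\<integral>\<^sup>+\<omega>. ennreal (f \<omega>) \<partial>P) - enn2ereal (\<integral>\<^sup>+\<omega>. ennreal (- f \<omega>) \<partial>P)"

definition quad_cost ::
  "'a measure \<Rightarrow> ('a \<Rightarrow> real^'n) \<Rightarrow> real^('n + 'm)^('n + 'm) \<Rightarrow> (real^'n \<Rightarrow> real^'m) \<Rightarrow> ereal" where
  "quad_cost P x W \<mu> = ext_expectation P (\<lambda>\<omega>. stack (x \<omega>) (\<mu> (x \<omega>)) \<bullet> (W *v stack (x \<omega>) (\<mu> (x \<omega>))))"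

definition admissible ::
  "'a measure \<Rightarrow> ('a \<Rightarrow> real^'n) \<Rightarrow> ('n::finite \<Rightarrow> 'd) \<Rightarrow> ('m::finite \<Rightarrow> 'd) \<Rightarrow>
   nat \<Rightarrow> (nat \<Rightarrow> real^('n + 'm)^('n + 'm)) \<Rightarrow> (nat \<Rightarrow> real) \<Rightarrow> (real^'n \<Rightarrow> real^'m) set" where
  "admissible P x bx bu M W \<gamma> =
     {\<mu> \<in> decisions bx bu. \<forall>j\<in>{1..M}. quad_cost P x (W j) \<mu> \<le> ereal (\<gamma> j)}"

definition feasible ::
  "'a measure \<Rightarrow> ('a \<Rightarrow> real^'n) \<Rightarrow> ('n::finite \<Rightarrow> 'd) \<Rightarrow> ('m::finite \<Rightarrow> 'd) \<Rightarrow>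
   nat \<Rightarrow> (nat \<Rightarrow> real^('n + 'm)^('n + 'm)) \<Rightarrow> (nat \<Rightarrow> real) \<Rightarrow> bool" where
  "feasible P x bx bu M W \<gamma> \<longleftrightarrow>
     (\<exists>\<mu> \<in> admissible P x bx bu M W \<gamma>. \<bar>quad_cost P x (W 0) \<mu>\<bar> \<noteq> \<infinity>)"

definition optimal ::
  "'a measure \<Rightarrow> ('a \<Rightarrow> real^'n) \<Rightarrow> ('n::finite \<Rightarrow> 'd) \<Rightarrow> ('m::finite \<Rightarrow> 'd) \<Rightarrow>
   nat \<Rightarrow> (nat \<Rightarrow> real^('n + 'm)^('n + 'm)) \<Rightarrow> (nat \<Rightarrow> real) \<Rightarrow> (real^'n \<Rightarrow> real^'m) \<Rightarrow> bool" where
  "optimal P x bx bu M W \<gamma> \<mu> \<longleftrightarrow>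
     is_arg_min (quad_cost P x (W 0)) (\<lambda>\<mu>. \<mu> \<in> admissible P x bx bu M W \<gamma>) \<mu>"

end

theory Submission
  imports Defs
begin

text \<open>
  A decision with finite objective is square integrable. Let \<open>K\<^sub>i x\<^sub>i\<close> be the \<open>L\<^sup>2\<close>-projection of
  \<open>\<mu>\<^sub>i(x\<^sub>i)\<close> onto the linear functions of \<open>x\<^sub>i\<close>. As \<open>x\<close> is Gaussian, every \<open>x\<^sub>j\<close> is a linear function
  of \<open>x\<^sub>i\<close> plus a part independent of \<open>x\<^sub>i\<close>, so the residual \<open>e = \<mu>(x) - K x\<close> is uncorrelated with the
  whole of \<open>x\<close>. Hence replacing \<open>\<mu>\<close> by \<open>K\<close> lowers the \<open>j\<close>th cost by \<open>E e\<^sup>T R\<^sub>j e \<ge> 0\<close>, and it remains to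
  find the best linear decision, a finite-dimensional problem depending on \<open>X\<close> only, which is
  solvable by compactness.

  The independence is obtained from characteristic functions: one-dimensional Levy uniqueness is
  applied coordinate by coordinate.
\<close>

section \<open>Square-integrable functions\<close>

text \<open>Two requirements shape the proof. K must depend on X alone although the probability
  space and the random vector vary; hence the cost of a linear decision is expressed through X, and
  one minimizer serves all of them. And X may be singular: no inverse of a covariance occurs,
  projections come from orthogonalization, and coercivity of the linear problem holds only modulo
  matrices that annihilate x almost surely.

  Full independence is never stated. What is needed is E(z g(y)) = 0 when z = b \<bullet> x is
  uncorrelated with the coordinates y and g is possibly nonlinear. It says that the signed measure
  with density z, pushed forward along y, integrates g to 0, and this measure vanishes because its
  Fourier transform does.\<close>

definition square_integrable :: "'a measure \<Rightarrow> ('a \<Rightarrow> real) \<Rightarrow> bool" where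
  "square_integrable P f \<longleftrightarrow> f \<in> borel_measurable P \<and> integrable P (\<lambda>\<omega>. (f \<omega>)\<^sup>2)"

lemma square_integrable_measurable: "square_integrable P f \<Longrightarrow> f \<in> borel_measurable P"
  by (simp add: square_integrable_def)

lemma square_integrable_mult:
  assumes "square_integrable P f" "square_integrable P g"
  shows "integrable P (\<lambda>\<omega>. f \<omega> * g \<omega>)"
proof (rule Bochner_Integration.integrable_bound)
  show "integrable P (\<lambda>\<omega>. (f \<omega>)\<^sup>2 + (g \<omega>)\<^sup>2)"
    using assms by (auto simp: square_integrable_def)
  show "(\<lambda>\<omega>. f \<omega> * g \<omega>) \<in> borel_measurable P"
    using assms by (auto simp: square_integrable_def)
  have "\<bar>a * b\<bar> \<le> a\<^sup>2 + b\<^sup>2" for a b :: real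
  proof -
    have "2 * \<bar>a * b\<bar> \<le> a\<^sup>2 + b\<^sup>2"
      using zero_le_power2[of "\<bar>a\<bar> - \<bar>b\<bar>"] by (simp add: power2_diff abs_mult)
    moreover have "0 \<le> \<bar>a * b\<bar>" by simp
    ultimately show ?thesis by linarith
  qed
  then show "AE \<omega> in P. norm (f \<omega> * g \<omega>) \<le> norm ((f \<omega>)\<^sup>2 + (g \<omega>)\<^sup>2)"
    by (intro AE_I2) (metis abs_of_nonneg add_nonneg_nonneg real_norm_def zero_le_power2)
qed

lemma square_integrable_scale:
  "square_integrable P f \<Longrightarrow> square_integrable P (\<lambda>\<omega>. c * f \<omega>)"
  by (auto simp: square_integrable_def power_mult_distrib)

lemma square_integrable_add:
  assumes "square_integrable P f" "square_integrable P g"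
  shows "square_integrable P (\<lambda>\<omega>. f \<omega> + g \<omega>)"
  using assms square_integrable_mult[OF assms]
  by (auto simp: square_integrable_def power2_sum mult.assoc)

lemma square_integrable_diff:
  assumes "square_integrable P f" "square_integrable P g"
  shows "square_integrable P (\<lambda>\<omega>. f \<omega> - g \<omega>)"
  using square_integrable_add[OF assms(1) square_integrable_scale[OF assms(2), of "-1"]] by simp

lemma square_integrable_sum:
  assumes "\<And>i. i \<in> I \<Longrightarrow> square_integrable P (f i)"
  shows "square_integrable P (\<lambda>\<omega>. \<Sum>i\<in>I. f i \<omega>)"
proof (cases "finite I")
  case True
  then show ?thesis using assms
  proof induction
    case empty
    show ?case by (simp add: square_integrable_def)
  next
    case (insert a I)
    then show ?case by (simp add: square_integrable_add)
  qed
qed (simp add: square_integrable_def)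

lemma (in prob_space) square_integrable_integrable:
  "square_integrable M f \<Longrightarrow> integrable M f"
  by (auto simp: square_integrable_def intro: square_integrable_imp_integrable)

text \<open>
  Gram--Schmidt; a new vector whose residual has norm 0 is almost surely a combination of
  the previous ones and needs no coefficient.
\<close>

lemma L2_projection:
  assumes "finite J" "\<And>l. l \<in> J \<Longrightarrow> square_integrable P (y l)" "square_integrable P f"
  shows "\<exists>c. \<forall>l\<in>J. (\<integral>\<omega>. (f \<omega> - (\<Sum>k\<in>J. c k * y k \<omega>)) * y l \<omega> \<partial>P) = (0::real)"
  using assms
proof (induction J arbitrary: f)
  case empty
  show ?case by simp
next
  case (insert a J)
  note sq = square_integrable_sum square_integrable_diff square_integrable_scale
  from insert.IH[of f] insert.prems obtain c where
    c: "\<And>l. l \<in> J \<Longrightarrow> (\<integral>\<omega>. (f \<omega> - (\<Sum>k\<in>J. c k * y k \<omega>)) * y l \<omega> \<partial>P) = 0" by auto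
  from insert.IH[of "y a"] insert.prems obtain d where
    d: "\<And>l. l \<in> J \<Longrightarrow> (\<integral>\<omega>. (y a \<omega> - (\<Sum>k\<in>J. d k * y k \<omega>)) * y l \<omega> \<partial>P) = 0" by auto
  define g where "g \<omega> = f \<omega> - (\<Sum>k\<in>J. c k * y k \<omega>)" for \<omega>
  define r where "r \<omega> = y a \<omega> - (\<Sum>k\<in>J. d k * y k \<omega>)" for \<omega>
  have y: "square_integrable P (y l)" if "l \<in> insert a J" for l using insert.prems that by auto
  have g: "square_integrable P g" and r: "square_integrable P r"
    unfolding g_def[abs_def] r_def[abs_def] using insert.prems by (auto intro!: sq)
  have g0: "(\<integral>\<omega>. g \<omega> * y l \<omega> \<partial>P) = 0" and r0: "(\<integral>\<omega>. r \<omega> * y l \<omega> \<partial>P) = 0" if "l \<in> J" for l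
    using c[OF that] d[OF that] by (simp_all add: g_def r_def)
  have ya: "y a \<omega> = r \<omega> + (\<Sum>k\<in>J. d k * y k \<omega>)" for \<omega> by (simp add: r_def)
  have expand: "(\<integral>\<omega>. h \<omega> * y a \<omega> \<partial>P) = (\<integral>\<omega>. h \<omega> * r \<omega> \<partial>P)"
    if h: "square_integrable P h" and h0: "\<And>l. l \<in> J \<Longrightarrow> (\<integral>\<omega>. h \<omega> * y l \<omega> \<partial>P) = 0" for h
  proof -
    have "(\<integral>\<omega>. h \<omega> * y a \<omega> \<partial>P) = (\<integral>\<omega>. h \<omega> * r \<omega> + (\<Sum>k\<in>J. d k * (h \<omega> * y k \<omega>)) \<partial>P)"
      by (simp add: ya algebra_simps sum_distrib_left)
    also have "\<dots> = (\<integral>\<omega>. h \<omega> * r \<omega> \<partial>P) + (\<Sum>k\<in>J. d k * (\<integral>\<omega>. h \<omega> * y k \<omega> \<partial>P))"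
      using y h r by (simp add: square_integrable_mult)
    finally show ?thesis using h0 by simp
  qed
  show ?case
  proof (cases "(\<integral>\<omega>. r \<omega> * r \<omega> \<partial>P) = 0")
    case True
    then have "AE \<omega> in P. r \<omega> * r \<omega> = 0"
      using square_integrable_mult[OF r r] by (subst (asm) integral_nonneg_eq_0_iff_AE) auto
    then have "(\<integral>\<omega>. g \<omega> * r \<omega> \<partial>P) = (\<integral>\<omega>. 0 \<partial>P)"
      using g r by (intro integral_cong_AE) (auto simp: square_integrable_def)
    then have "(\<integral>\<omega>. g \<omega> * y a \<omega> \<partial>P) = 0"
      using expand[OF g g0] by simp
    then have "\<forall>l\<in>insert a J. (\<integral>\<omega>. g \<omega> * y l \<omega> \<partial>P) = 0" using g0 by simp
    moreover have "g \<omega> = f \<omega> - (\<Sum>k\<in>insert a J. (c(a := 0)) k * y k \<omega>)" for \<omega>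
      using insert.hyps by (auto simp: g_def intro!: sum.cong)
    ultimately show ?thesis by (intro exI[of _ "c(a := 0)"]) simp
  next
    case False
    \<comment> \<open>\<open>s\<close> is the coefficient of \<open>g\<close> along
      \<open>r\<close>. Writing \<open>r\<close> back in terms of \<open>y a\<close> and the old
      vectors yields the coefficients \<open>c'\<close>.\<close>
    define s where "s = (\<integral>\<omega>. g \<omega> * r \<omega> \<partial>P) / (\<integral>\<omega>. r \<omega> * r \<omega> \<partial>P)"
    define c' where "c' k = (if k = a then s else c k - s * d k)" for k
    define h where "h \<omega> = g \<omega> - s * r \<omega>" for \<omega>
    have h: "square_integrable P h" unfolding h_def[abs_def] using g r by (auto intro!: sq)
    have hint: "(\<integral>\<omega>. h \<omega> * q \<omega> \<partial>P) = (\<integral>\<omega>. g \<omega> * q \<omega> \<partial>P) - s * (\<integral>\<omega>. r \<omega> * q \<omega> \<partial>P)"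
      if "square_integrable P q" for q
      using g r that by (simp add: h_def left_diff_distrib mult.assoc square_integrable_mult)
    have h0: "(\<integral>\<omega>. h \<omega> * y l \<omega> \<partial>P) = 0" if "l \<in> J" for l
      using hint[OF y] that g0 r0 by simp
    have "(\<integral>\<omega>. h \<omega> * y a \<omega> \<partial>P) = 0"
      using expand[OF h h0] hint[OF r] False by (simp add: s_def)
    then have "\<forall>l\<in>insert a J. (\<integral>\<omega>. h \<omega> * y l \<omega> \<partial>P) = 0" using h0 by simp
    moreover have "h \<omega> = f \<omega> - (\<Sum>k\<in>insert a J. c' k * y k \<omega>)" for \<omega>
    proof -
      have "(\<Sum>k\<in>J. c' k * y k \<omega>) = (\<Sum>k\<in>J. c k * y k \<omega> - s * (d k * y k \<omega>))"
        using insert.hyps by (intro sum.cong) (auto simp: c'_def algebra_simps)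
      then have "(\<Sum>k\<in>insert a J. c' k * y k \<omega>) =
          s * y a \<omega> + (\<Sum>k\<in>J. c k * y k \<omega>) - s * (\<Sum>k\<in>J. d k * y k \<omega>)"
        using insert.hyps by (simp add: sum_subtractf sum_distrib_left c'_def)
      then show ?thesis by (simp add: h_def g_def r_def algebra_simps)
    qed
    ultimately show ?thesis by (intro exI[of _ c']) simp
  qed
qed

section \<open>Fourier uniqueness\<close>

text \<open>\<open>ennreal\<close> sends negative reals to 0, so the two densities are the positive
  and the negative part of \<open>z\<close>. Equality of their images means that the signed measure
  with density \<open>z\<close> has image zero under \<open>y\<close>.\<close>

lemma integral_mult_eq_0_if_distr_eq:
  fixes z :: "'a \<Rightarrow> real" and g :: "'b \<Rightarrow> real"
  assumes z: "z \<in> borel_measurable P" and y: "y \<in> P \<rightarrow>\<^sub>M N" and g: "g \<in> borel_measurable N"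
    and int: "integrable P (\<lambda>\<omega>. z \<omega> * g (y \<omega>))"
    and eq: "distr (density P (\<lambda>\<omega>. ennreal (z \<omega>))) N y = distr (density P (\<lambda>\<omega>. ennreal (- z \<omega>))) N y"
  shows "(\<integral>\<omega>. z \<omega> * g (y \<omega>) \<partial>P) = 0"
proof -
  note [measurable] = z y g
  have I: "(\<integral>\<omega>. f \<omega> * g (y \<omega>) \<partial>P) = integral\<^sup>L (distr (density P (\<lambda>\<omega>. ennreal (f \<omega>))) N y) g"
    if [measurable]: "f \<in> borel_measurable P" and "\<And>\<omega>. 0 \<le> f \<omega>" for f
    using that by (subst integral_distr) (auto simp: integral_density)
  have int': "integrable P (\<lambda>\<omega>. f \<omega> * g (y \<omega>))"
    if [measurable]: "f \<in> borel_measurable P" and "\<And>\<omega>. \<bar>f \<omega>\<bar> \<le> \<bar>z \<omega>\<bar>" for f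
    using that by (intro Bochner_Integration.integrable_bound[OF int])
      (auto simp: abs_mult intro!: mult_right_mono)
  have "(\<integral>\<omega>. z \<omega> * g (y \<omega>) \<partial>P) =
      (\<integral>\<omega>. max 0 (z \<omega>) * g (y \<omega>) - max 0 (- z \<omega>) * g (y \<omega>) \<partial>P)"
    by (intro Bochner_Integration.integral_cong) (auto simp: max_def)
  also have "\<dots> = (\<integral>\<omega>. max 0 (z \<omega>) * g (y \<omega>) \<partial>P) - (\<integral>\<omega>. max 0 (- z \<omega>) * g (y \<omega>) \<partial>P)"
    by (intro Bochner_Integration.integral_diff int') auto
  also have "\<dots> = 0" by (simp add: I eq)
  finally show ?thesis .
qed

lemma integrable_mult_iexp:
  fixes h :: "'a \<Rightarrow> complex"
  assumes "integrable P h" "y \<in> borel_measurable P"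
  shows "integrable P (\<lambda>\<omega>. h \<omega> * iexp (y \<omega>))"
proof (rule Bochner_Integration.integrable_bound[OF assms(1)])
  show "(\<lambda>\<omega>. h \<omega> * iexp (y \<omega>)) \<in> borel_measurable P" using assms by measurable
qed (simp add: norm_mult)

text \<open>Both parts of \<open>z\<close> have the same transform along \<open>y\<close>, and its
  value at 0 is their common mass \<open>m\<close>. Divided by \<open>m\<close>, they become
  probability distributions with equal characteristic functions, which Levy uniqueness
  identifies.\<close>

lemma integral_mult_eq_0_if_fourier_eq_0_real:
  fixes z y :: "'a \<Rightarrow> real"
  assumes z: "integrable P z" and y: "y \<in> borel_measurable P"
    and g: "g \<in> borel_measurable borel" and int: "integrable P (\<lambda>\<omega>. z \<omega> * g (y \<omega>))"
    and 0: "\<And>t. (\<integral>\<omega>. of_real (z \<omega>) * iexp (t * y \<omega>) \<partial>P) = 0"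
  shows "(\<integral>\<omega>. z \<omega> * g (y \<omega>) \<partial>P) = 0"
proof (rule integral_mult_eq_0_if_distr_eq[OF borel_measurable_integrable[OF z] y g int])
  note [measurable] = borel_measurable_integrable[OF z] y
  define D where "D f = distr (density P (\<lambda>\<omega>. ennreal (f \<omega>))) borel y" for f :: "'a \<Rightarrow> real"
  define p where "p \<omega> = max 0 (z \<omega>)" for \<omega>
  define q where "q \<omega> = max 0 (- z \<omega>)" for \<omega>
  have [measurable]: "p \<in> borel_measurable P" "q \<in> borel_measurable P"
    by (simp_all add: p_def[abs_def] q_def[abs_def])
  have nn: "0 \<le> p \<omega>" "0 \<le> q \<omega>" for \<omega> by (simp_all add: p_def q_def)
  have p: "integrable P p" and q: "integrable P q"
    using z by (auto simp: p_def[abs_def] q_def[abs_def] intro!: integrable_max)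
  have zpq: "z \<omega> = p \<omega> - q \<omega>" for \<omega> by (simp add: p_def q_def max_def)
  have pq: "(\<integral>\<omega>. of_real (p \<omega>) * iexp (t * y \<omega>) \<partial>P) = (\<integral>\<omega>. of_real (q \<omega>) * iexp (t * y \<omega>) \<partial>P)" for t
  proof -
    have i: "integrable P (\<lambda>\<omega>. of_real (p \<omega>) * iexp (t * y \<omega>))"
      "integrable P (\<lambda>\<omega>. of_real (q \<omega>) * iexp (t * y \<omega>))"
      by (rule integrable_mult_iexp; use p q in simp)+
    have "(\<integral>\<omega>. of_real (p \<omega>) * iexp (t * y \<omega>) - of_real (q \<omega>) * iexp (t * y \<omega>) \<partial>P) = 0"
      using 0[of t] by (simp add: zpq left_diff_distrib)
    then show ?thesis
      by (subst (asm) Bochner_Integration.integral_diff[OF i]) simp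
  qed
  define m where "m = (\<integral>\<omega>. p \<omega> \<partial>P)"
  have mq: "m = (\<integral>\<omega>. q \<omega> \<partial>P)" using pq[of 0] by (simp add: m_def)
  have "D p = D q"
  proof (cases "m = 0")
    \<comment> \<open>Without mass there is nothing to normalize, but then both parts vanish almost
      everywhere.\<close>
    case True
    have "AE \<omega> in P. p \<omega> = 0"
      by (subst integral_nonneg_eq_0_iff_AE[symmetric]) (use p nn True in \<open>auto simp: m_def\<close>)
    moreover have "AE \<omega> in P. q \<omega> = 0"
      by (subst integral_nonneg_eq_0_iff_AE[symmetric]) (use q nn True mq in auto)
    ultimately have "density P (\<lambda>\<omega>. ennreal (p \<omega>)) = density P (\<lambda>\<omega>. ennreal (q \<omega>))"
      by (intro density_cong) auto
    then show ?thesis by (simp add: D_def)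
  next
    case False
    then have m: "0 < m" using nn by (simp add: m_def less_le)
    have RD: "real_distribution (D (\<lambda>\<omega>. f \<omega> / m))"
      and chr: "char (D (\<lambda>\<omega>. f \<omega> / m)) t = (\<integral>\<omega>. of_real (f \<omega>) * iexp (t * y \<omega>) \<partial>P) / m"
      if [measurable]: "f \<in> borel_measurable P" and f: "\<And>\<omega>. 0 \<le> f \<omega>" "integrable P f" "(\<integral>\<omega>. f \<omega> \<partial>P) = m" for f t
    proof -
      have "(\<integral>\<^sup>+\<omega>. ennreal (f \<omega> / m) \<partial>P) = 1"
        using f m by (subst nn_integral_eq_integral) auto
      then interpret d: prob_space "density P (\<lambda>\<omega>. ennreal (f \<omega> / m))"
        by (intro prob_spaceI) (simp add: emeasure_density cong: nn_integral_cong)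
      show "real_distribution (D (\<lambda>\<omega>. f \<omega> / m))"
        unfolding D_def by (rule d.real_distribution_distr) simp
      have "char (D (\<lambda>\<omega>. f \<omega> / m)) t = (\<integral>\<omega>. (f \<omega> / m) *\<^sub>R iexp (t * y \<omega>) \<partial>P)"
        unfolding char_def D_def using f m by (subst integral_distr) (auto simp: integral_density)
      then show "char (D (\<lambda>\<omega>. f \<omega> / m)) t = (\<integral>\<omega>. of_real (f \<omega>) * iexp (t * y \<omega>) \<partial>P) / m"
        by (simp add: scaleR_conv_of_real)
    qed
    have "D (\<lambda>\<omega>. p \<omega> / m) = D (\<lambda>\<omega>. q \<omega> / m)"
    proof (intro Levy_uniqueness RD ext)
      show "char (D (\<lambda>\<omega>. p \<omega> / m)) t = char (D (\<lambda>\<omega>. q \<omega> / m)) t" for t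
        by (simp only: chr[of p] chr[of q] nn p q m_def[symmetric] mq[symmetric] pq \<open>p \<in> _\<close> \<open>q \<in> _\<close>)
    qed (use nn p q mq in \<open>auto simp: m_def\<close>)
    then have E: "emeasure (D (\<lambda>\<omega>. p \<omega> / m)) A = emeasure (D (\<lambda>\<omega>. q \<omega> / m)) A" for A by simp
    have *: "(\<integral>\<^sup>+\<omega>. ennreal (p \<omega> / m) * indicator (y -` A \<inter> space P) \<omega> \<partial>P) =
        (\<integral>\<^sup>+\<omega>. ennreal (q \<omega> / m) * indicator (y -` A \<inter> space P) \<omega> \<partial>P)" if "A \<in> sets borel" for A
      using E[of A] that by (simp add: D_def emeasure_density emeasure_distr)
    have scale: "(\<integral>\<^sup>+\<omega>. ennreal (f \<omega>) * indicator B \<omega> \<partial>P) =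
       m * (\<integral>\<^sup>+\<omega>. ennreal (f \<omega> / m) * indicator B \<omega> \<partial>P)"
      if [measurable]: "B \<in> sets P" "f \<in> borel_measurable P" and f: "\<And>\<omega>. 0 \<le> f \<omega>" for B f
    proof -
      have "ennreal (f \<omega>) = ennreal m * ennreal (f \<omega> / m)" for \<omega>
        using m f by (simp add: ennreal_mult[symmetric])
      then have "(\<integral>\<^sup>+\<omega>. ennreal (f \<omega>) * indicator B \<omega> \<partial>P) =
          (\<integral>\<^sup>+\<omega>. ennreal m * (ennreal (f \<omega> / m) * indicator B \<omega>) \<partial>P)"
        by (simp only: mult.assoc)
      also have "\<dots> = m * (\<integral>\<^sup>+\<omega>. ennreal (f \<omega> / m) * indicator B \<omega> \<partial>P)"
        by (rule nn_integral_cmult) measurable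
      finally show ?thesis .
    qed
    show ?thesis
    proof (rule measure_eqI)
      fix A assume "A \<in> sets (D p)"
      then have A: "A \<in> sets borel" and "y -` A \<inter> space P \<in> sets P"
        by (auto simp: D_def intro: measurable_sets[OF y])
      then have "emeasure (D f) A = m * (\<integral>\<^sup>+\<omega>. ennreal (f \<omega> / m) * indicator (y -` A \<inter> space P) \<omega> \<partial>P)"
        if "f \<in> borel_measurable P" "\<And>\<omega>. 0 \<le> f \<omega>" for f
        using that scale[of "y -` A \<inter> space P" f] by (simp add: D_def emeasure_distr emeasure_density)
      then show "emeasure (D p) A = emeasure (D q) A"
        by (simp only: nn * [OF A] \<open>p \<in> _\<close> \<open>q \<in> _\<close>)
    qed (simp add: D_def)
  qed
  then show "distr (density P (\<lambda>\<omega>. ennreal (z \<omega>))) borel y =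
      distr (density P (\<lambda>\<omega>. ennreal (- z \<omega>))) borel y"
    by (simp add: D_def p_def q_def)
qed

text \<open>Complex weights occur twice later: the induction over coordinates moves characters into
  the weight, and for Gaussian vectors the weight is a centered character. Conjugation turns the
  transform of \<open>h\<close> at \<open>- t\<close> into that of \<open>cnj h\<close> at
  \<open>t\<close>, so both vanish, and \<open>Re h\<close> and \<open>Im h\<close> are combinations
  of the two.\<close>

lemma integral_mult_eq_0_if_fourier_eq_0:
  fixes h :: "'a \<Rightarrow> complex" and y :: "'a \<Rightarrow> real"
  assumes h: "integrable P h" and y: "y \<in> borel_measurable P"
    and g: "g \<in> borel_measurable borel" and int: "integrable P (\<lambda>\<omega>. h \<omega> * of_real (g (y \<omega>)))"
    and 0: "\<And>t. (\<integral>\<omega>. h \<omega> * iexp (t * y \<omega>) \<partial>P) = 0"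
  shows "(\<integral>\<omega>. h \<omega> * of_real (g (y \<omega>)) \<partial>P) = 0"
proof -
  have i: "integrable P (\<lambda>\<omega>. h \<omega> * iexp (t * y \<omega>))" for t
    by (rule integrable_mult_iexp) (use h y in auto)
  have cnj: "cnj (h \<omega>) * iexp (t * y \<omega>) = cnj (h \<omega> * iexp (- t * y \<omega>))" for t \<omega>
    by (simp add: exp_cnj)
  have c: "integrable P (\<lambda>\<omega>. cnj (h \<omega>) * iexp (t * y \<omega>))"
    and c0: "(\<integral>\<omega>. cnj (h \<omega>) * iexp (t * y \<omega>) \<partial>P) = 0" for t
    unfolding cnj using i[of "- t"] 0[of "- t"] by (simp_all del: complex_cnj_mult)
  have Re: "(\<integral>\<omega>. Re (h \<omega>) * g (y \<omega>) \<partial>P) = 0"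
  proof (rule integral_mult_eq_0_if_fourier_eq_0_real[OF _ y g])
    show "integrable P (\<lambda>\<omega>. Re (h \<omega>) * g (y \<omega>))" using integrable_Re[OF int] by simp
    fix t
    have "of_real (Re (h \<omega>)) * iexp (t * y \<omega>) =
        (h \<omega> * iexp (t * y \<omega>) + cnj (h \<omega>) * iexp (t * y \<omega>)) / 2" for \<omega>
      by (simp add: distrib_right[symmetric] complex_add_cnj)
    then show "(\<integral>\<omega>. of_real (Re (h \<omega>)) * iexp (t * y \<omega>) \<partial>P) = 0"
      using i[of t] c[of t] 0[of t] c0[of t] by (simp only: integral_divide_zero Bochner_Integration.integral_add) simp
  qed (use h in simp)
  have Im: "(\<integral>\<omega>. Im (h \<omega>) * g (y \<omega>) \<partial>P) = 0"
  proof (rule integral_mult_eq_0_if_fourier_eq_0_real[OF _ y g])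
    show "integrable P (\<lambda>\<omega>. Im (h \<omega>) * g (y \<omega>))" using integrable_Im[OF int] by simp
    fix t
    have "of_real (Im (h \<omega>)) * iexp (t * y \<omega>) =
        (h \<omega> * iexp (t * y \<omega>) - cnj (h \<omega>) * iexp (t * y \<omega>)) / (2 * \<i>)" for \<omega>
      by (simp only: left_diff_distrib[symmetric] complex_diff_cnj) (simp add: field_simps)
    then show "(\<integral>\<omega>. of_real (Im (h \<omega>)) * iexp (t * y \<omega>) \<partial>P) = 0"
      using i[of t] c[of t] 0[of t] c0[of t] by (simp only: integral_divide_zero Bochner_Integration.integral_diff) simp
  qed (use h in simp)
  show ?thesis
    using Re Im integral_Re[OF int] integral_Im[OF int] by (intro complex_eqI) auto
qed

text \<open>Characters are traded for indicators one coordinate at a time. With a character of the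
  coordinates in \<open>J\<close> absorbed into the weight, the one-dimensional result replaces the
  character of \<open>y a\<close> by an indicator; the induction hypothesis then applies to the new
  weight \<open>h'\<close>.\<close>

lemma integral_mult_prod_indicator_eq_0_if_fourier_eq_0:
  fixes h :: "'a \<Rightarrow> complex" and y :: "'k \<Rightarrow> 'a \<Rightarrow> real"
  assumes "finite J" "\<And>k. k \<in> J \<Longrightarrow> y k \<in> borel_measurable P" "integrable P h"
    and "\<And>t. (\<integral>\<omega>. h \<omega> * iexp (\<Sum>k\<in>J. t k * y k \<omega>) \<partial>P) = 0"
    and "\<And>k. k \<in> J \<Longrightarrow> A k \<in> sets borel"
  shows "(\<integral>\<omega>. h \<omega> * of_real (\<Prod>k\<in>J. indicator (A k) (y k \<omega>) :: real) \<partial>P) = 0"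
  using assms
proof (induction J arbitrary: h)
  case empty
  from empty.prems(3) show ?case by simp
next
  case (insert a J)
  have [measurable]: "y a \<in> borel_measurable P" "A a \<in> sets borel" and y: "\<And>k. k \<in> J \<Longrightarrow> y k \<in> borel_measurable P"
    using insert.prems by auto
  have int: "integrable P (\<lambda>\<omega>. f \<omega> * of_real (indicator (A a) (y a \<omega>)))"
    if f: "integrable P f" for f :: "'a \<Rightarrow> complex"
  proof (rule Bochner_Integration.integrable_bound[OF f])
    show "(\<lambda>\<omega>. f \<omega> * of_real (indicator (A a) (y a \<omega>))) \<in> borel_measurable P"
      using borel_measurable_integrable[OF f] by measurable
  qed (auto simp: norm_mult indicator_def)
  define h' where "h' \<omega> = h \<omega> * of_real (indicator (A a) (y a \<omega>))" for \<omega>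
  have "(\<integral>\<omega>. h' \<omega> * of_real (\<Prod>k\<in>J. indicator (A k) (y k \<omega>) :: real) \<partial>P) = 0"
  proof (rule insert.IH)
    show "integrable P h'" unfolding h'_def[abs_def] using insert.prems by (intro int)
    fix t
    define f where "f \<omega> = h \<omega> * iexp (\<Sum>k\<in>J. t k * y k \<omega>)" for \<omega>
    have "(\<lambda>\<omega>. \<Sum>k\<in>J. t k * y k \<omega>) \<in> borel_measurable P" using y by measurable
    then have f: "integrable P f"
      unfolding f_def[abs_def] using insert.prems(2) by (intro integrable_mult_iexp)
    have "(\<integral>\<omega>. f \<omega> * of_real (indicator (A a) (y a \<omega>)) \<partial>P) = 0"
    proof (rule integral_mult_eq_0_if_fourier_eq_0[where h = f and y = "y a" and g = "indicator (A a)"])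
      show "integrable P f" by (rule f)
      show "integrable P (\<lambda>\<omega>. f \<omega> * of_real (indicator (A a) (y a \<omega>)))" by (rule int[OF f])
      fix s
      \<comment> \<open>The frequency \<open>s\<close> of coordinate \<open>a\<close> can be varied
        alone because the hypothesis holds for every \<open>t\<close>.\<close>
      have "iexp (\<Sum>k\<in>insert a J. (t(a := s)) k * y k \<omega>) = iexp (\<Sum>k\<in>J. t k * y k \<omega>) * iexp (s * y a \<omega>)" for \<omega>
      proof -
        have "(\<Sum>k\<in>insert a J. (t(a := s)) k * y k \<omega>) = (\<Sum>k\<in>J. t k * y k \<omega>) + s * y a \<omega>"
          using insert.hyps by (subst sum.insert) (auto intro!: sum.cong)
        then show ?thesis by (simp only: distrib_left exp_add of_real_add)
      qed
      with insert.prems(3)[of "t(a := s)"]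
      show "(\<integral>\<omega>. f \<omega> * iexp (s * y a \<omega>) \<partial>P) = 0" by (simp only: f_def mult.assoc)
    qed measurable
    then show "(\<integral>\<omega>. h' \<omega> * iexp (\<Sum>k\<in>J. t k * y k \<omega>) \<partial>P) = 0"
      by (simp add: f_def h'_def ac_simps)
  qed (use insert.prems in auto)
  then show ?case using insert.hyps by (simp add: h'_def mult.assoc)
qed

text \<open>Boxes form an intersection-stable generator of the product space and the images of both
  parts of \<open>z\<close> are finite measures, so it suffices that \<open>z\<close> integrates to
  0 over preimages of boxes.\<close>

lemma integral_mult_eq_0_if_fourier_eq_0_PiM:
  fixes z :: "'a \<Rightarrow> real" and y :: "'a \<Rightarrow> 'k \<Rightarrow> real"
  assumes J: "finite J" and z: "integrable P z" and y: "y \<in> P \<rightarrow>\<^sub>M (\<Pi>\<^sub>M k\<in>J. borel)"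
    and g: "g \<in> borel_measurable (\<Pi>\<^sub>M k\<in>J. borel)" and int: "integrable P (\<lambda>\<omega>. z \<omega> * g (y \<omega>))"
    and 0: "\<And>t. (\<integral>\<omega>. of_real (z \<omega>) * iexp (\<Sum>k\<in>J. t k * y \<omega> k) \<partial>P) = 0"
  shows "(\<integral>\<omega>. z \<omega> * g (y \<omega>) \<partial>P) = 0"
proof (rule integral_mult_eq_0_if_distr_eq[where z = z and y = y and g = g, OF borel_measurable_integrable[OF z] y g int])
  let ?N = "\<Pi>\<^sub>M k\<in>J. borel :: real measure"
  let ?D = "\<lambda>f. distr (density P (\<lambda>\<omega>. ennreal (f \<omega>))) ?N y"
  note [measurable] = borel_measurable_integrable[OF z]
  have yk: "(\<lambda>\<omega>. y \<omega> k) \<in> borel_measurable P" if "k \<in> J" for k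
    using measurable_compose[OF y measurable_component_singleton[OF that]] .
  show "?D z = ?D (\<lambda>\<omega>. - z \<omega>)"
  proof (rule measure_eqI_PiM_finite[OF J])
    fix A assume A: "\<And>k. k \<in> J \<Longrightarrow> A k \<in> sets (borel :: real measure)"
    have PA [measurable]: "Pi\<^sub>E J A \<in> sets ?N" using A J by (intro sets_PiM_I_finite) auto
    have [measurable]: "y -` Pi\<^sub>E J A \<inter> space P \<in> sets P" using y PA by (rule measurable_sets)
    \<comment> \<open>Values of \<open>y\<close> are extensional, so membership in
      \<open>Pi\<^sub>E J A\<close> is a condition on the coordinates in \<open>J\<close>
      only.\<close>
    have prod: "(\<Prod>k\<in>J. indicator (A k) (y \<omega> k)) = (indicator (y -` Pi\<^sub>E J A \<inter> space P) \<omega> :: real)"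
      if "\<omega> \<in> space P" for \<omega>
      using measurable_space[OF y that] that J
      by (auto simp: indicator_def space_PiM PiE_def prod_zero_iff Pi_iff)
    have m: "emeasure (?D f) (Pi\<^sub>E J A) = ennreal (\<integral>\<omega>. max 0 (f \<omega>) * indicator (y -` Pi\<^sub>E J A \<inter> space P) \<omega> \<partial>P)"
      if f: "integrable P f" for f
    proof -
      note [measurable] = borel_measurable_integrable[OF f]
      have "emeasure (?D f) (Pi\<^sub>E J A) =
          (\<integral>\<^sup>+\<omega>. ennreal (f \<omega>) * indicator (y -` Pi\<^sub>E J A \<inter> space P) \<omega> \<partial>P)"
        using y PA by (simp add: emeasure_distr emeasure_density)
      also have "\<dots> = (\<integral>\<^sup>+\<omega>. ennreal (max 0 (f \<omega>) * indicator (y -` Pi\<^sub>E J A \<inter> space P) \<omega>) \<partial>P)"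
        by (intro nn_integral_cong) (auto simp: indicator_def)
      also have "\<dots> = ennreal (\<integral>\<omega>. max 0 (f \<omega>) * indicator (y -` Pi\<^sub>E J A \<inter> space P) \<omega> \<partial>P)"
        by (intro nn_integral_eq_integral integrable_real_mult_indicator integrable_max) (use f in auto)
      finally show ?thesis .
    qed
    have "(\<integral>\<omega>. of_real (z \<omega>) * of_real (\<Prod>k\<in>J. indicator (A k) (y \<omega> k)) \<partial>P) = (0 :: complex)"
      using A z 0 yk J by (intro integral_mult_prod_indicator_eq_0_if_fourier_eq_0) auto
    also have "(\<integral>\<omega>. of_real (z \<omega>) * of_real (\<Prod>k\<in>J. indicator (A k) (y \<omega> k)) \<partial>P) =
       (\<integral>\<omega>. complex_of_real (z \<omega> * indicator (y -` Pi\<^sub>E J A \<inter> space P) \<omega>) \<partial>P)"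
      by (intro Bochner_Integration.integral_cong) (simp_all only: prod of_real_mult)
    finally have "(\<integral>\<omega>. z \<omega> * indicator (y -` Pi\<^sub>E J A \<inter> space P) \<omega> \<partial>P) = 0"
      by (simp only: integral_complex_of_real of_real_eq_0_iff)
    also have "(\<integral>\<omega>. z \<omega> * indicator (y -` Pi\<^sub>E J A \<inter> space P) \<omega> \<partial>P) =
      (\<integral>\<omega>. max 0 (z \<omega>) * indicator (y -` Pi\<^sub>E J A \<inter> space P) \<omega>
        - max 0 (- z \<omega>) * indicator (y -` Pi\<^sub>E J A \<inter> space P) \<omega> \<partial>P)"
      by (intro Bochner_Integration.integral_cong) (auto simp: max_def)
    also have "\<dots> = (\<integral>\<omega>. max 0 (z \<omega>) * indicator (y -` Pi\<^sub>E J A \<inter> space P) \<omega> \<partial>P)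
        - (\<integral>\<omega>. max 0 (- z \<omega>) * indicator (y -` Pi\<^sub>E J A \<inter> space P) \<omega> \<partial>P)"
      by (intro Bochner_Integration.integral_diff integrable_real_mult_indicator integrable_max) (use z in auto)
    finally show "emeasure (?D z) (Pi\<^sub>E J A) = emeasure (?D (\<lambda>\<omega>. - z \<omega>)) (Pi\<^sub>E J A)"
      using z m[OF z] m[of "\<lambda>\<omega>. - z \<omega>"] by simp
  next
    \<comment> \<open>A constant exhaustion suffices: integrability of \<open>z\<close> gives the
      whole space finite mass.\<close>
    let ?A = "\<lambda>i::nat. Pi\<^sub>E J (\<lambda>k. UNIV :: real set)"
    show "range ?A \<subseteq> prod_algebra J (\<lambda>k. borel)" using J by (auto intro!: prod_algebraI_finite)
    show "(\<Union>i. ?A i) = space ?N" by (simp add: space_PiM)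
    have "integrable P (\<lambda>\<omega>. max 0 (z \<omega>))" using z by (intro integrable_max) auto
    then have "(\<integral>\<^sup>+\<omega>. ennreal (max 0 (z \<omega>)) \<partial>P) \<noteq> \<infinity>"
      by (subst nn_integral_eq_integral) auto
    then have "emeasure (?D z) (space (?D z)) \<noteq> \<infinity>"
      using y measurable_space[OF y] by (simp add: emeasure_distr emeasure_density cong: nn_integral_cong)
    then show "emeasure (?D z) (?A i) \<noteq> \<infinity>" for i :: nat
      using emeasure_space[of "?D z" "?A i"] by (auto simp: top_unique)
  qed simp_all
qed

section \<open>Gaussian vectors\<close>

text \<open>Collects what is used of the normal density. Standardizing \<open>Y\<close> reduces its
  characteristic function to the standard normal one.\<close>

lemma (in prob_space) normal_distributed_moments:
  assumes D: "distributed M lborel Y (normal_density c \<sigma>)" and "0 < \<sigma>"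
  shows "square_integrable M Y" "expectation Y = c" "expectation (\<lambda>\<omega>. (Y \<omega> - c)\<^sup>2) = \<sigma>\<^sup>2"
    "(\<integral>\<omega>. iexp (Y \<omega>) \<partial>M) = iexp c * of_real (exp (- \<sigma>\<^sup>2 / 2))"
proof -
  have Y [measurable]: "Y \<in> borel_measurable M" using distributed_measurable[OF D] by simp
  show E: "expectation Y = c" by (rule normal_distributed_expectation[OF assms(2) D])
  show "expectation (\<lambda>\<omega>. (Y \<omega> - c)\<^sup>2) = \<sigma>\<^sup>2"
    using normal_distributed_variance[OF assms(2) D] E by simp
  have I: "integrable M (\<lambda>\<omega>. (Y \<omega> - c) ^ k)" for k
    using distributed_integrable[OF D, of "\<lambda>y. (y - c) ^ k"] integrable_normal_moment[OF assms(2), of c k]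
    by (simp add: normal_density_nonneg)
  have "(\<lambda>\<omega>. (Y \<omega>)\<^sup>2) = (\<lambda>\<omega>. (Y \<omega> - c) ^ 2 + 2 * c * (Y \<omega> - c) ^ 1 + c\<^sup>2)"
    by (simp add: fun_eq_iff power2_eq_square algebra_simps)
  then show "square_integrable M Y"
    unfolding square_integrable_def using I[of 2] I[of 1] by simp
  define Z where "Z \<omega> = (Y \<omega> - c) / \<sigma>" for \<omega>
  have Z: "distributed M lborel Z std_normal_density"
    using normal_standard_normal_convert[OF assms(2)] D by (simp add: Z_def[abs_def])
  have Zm: "Z \<in> borel_measurable M" by (simp add: Z_def[abs_def])
  have "(\<integral>\<omega>. iexp (\<sigma> * Z \<omega>) \<partial>M) = char (distr M lborel Z) \<sigma>"
    unfolding char_def using Zm by (subst integral_distr) auto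
  also have "distr M lborel Z = std_normal_distribution"
    using Z by (simp add: distributed_def)
  also have "char std_normal_distribution \<sigma> = of_real (exp (- \<sigma>\<^sup>2 / 2))"
    by (simp add: char_std_normal_distribution)
  finally have "(\<integral>\<omega>. iexp (\<sigma> * Z \<omega>) \<partial>M) = of_real (exp (- \<sigma>\<^sup>2 / 2))" .
  moreover have "iexp (Y \<omega>) = iexp c * iexp (\<sigma> * Z \<omega>)" for \<omega>
  proof -
    have "Y \<omega> = c + \<sigma> * Z \<omega>" using assms(2) by (simp add: Z_def)
    then show ?thesis by (simp only: distrib_left exp_add of_real_add)
  qed
  ultimately show "(\<integral>\<omega>. iexp (Y \<omega>) \<partial>M) = iexp c * of_real (exp (- \<sigma>\<^sup>2 / 2))"
    by (simp only: integral_mult_right_zero)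
qed

text \<open>\<open>X\<close> is a parameter so that instances on different probability spaces can
  share it: one matrix has to be optimal for all of them.\<close>

locale centered_gaussian = prob_space P for P :: "'a measure" +
  fixes x :: "'a \<Rightarrow> real^'n::finite" and X :: "real^'n^'n"
  assumes gaussian: "gaussian_vector P x" and mean_zero: "integral\<^sup>L P x = 0"
    and covariance: "covariance_matrix P x = X"
begin

lemma measurable_x [measurable]: "x \<in> borel_measurable P"
  using gaussian by (simp add: gaussian_vector_def)

lemma square_integrable_inner: "square_integrable P (\<lambda>\<omega>. a \<bullet> x \<omega>)"
proof -
  consider c where "AE \<omega> in P. a \<bullet> x \<omega> = c"
    | c \<sigma> where "\<sigma> > 0" "distributed P lborel (\<lambda>\<omega>. a \<bullet> x \<omega>) (normal_density c \<sigma>)"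
    using gaussian unfolding gaussian_vector_def by blast
  then show ?thesis
  proof cases
    case 1
    then have "AE \<omega> in P. (a \<bullet> x \<omega>)\<^sup>2 = c\<^sup>2" by auto
    then have "integrable P (\<lambda>\<omega>. (a \<bullet> x \<omega>)\<^sup>2) \<longleftrightarrow> integrable P (\<lambda>\<omega>. c\<^sup>2)"
      by (intro integrable_cong_AE) auto
    then show ?thesis by (simp add: square_integrable_def)
  next
    case 2
    then show ?thesis by (intro normal_distributed_moments)
  qed
qed

lemma square_integrable_component: "square_integrable P (\<lambda>\<omega>. x \<omega> $ k)"
  using square_integrable_inner[of "axis k 1"] by (simp add: cart_eq_inner_axis inner_commute)

lemma measurable_component_x [measurable]: "(\<lambda>\<omega>. x \<omega> $ k) \<in> borel_measurable P"
  by (rule square_integrable_measurable[OF square_integrable_component])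

text \<open>\<open>mean_zero\<close> alone says little, since a nonintegrable \<open>x\<close> has
  Bochner integral 0 by convention. Integrability is first derived from square integrability in
  every direction; then linearity applies.\<close>

lemma expectation_inner: "(\<integral>\<omega>. a \<bullet> x \<omega> \<partial>P) = 0"
proof -
  have "integrable P (\<lambda>\<omega>. (x \<omega> \<bullet> b) *\<^sub>R b)" for b
    using square_integrable_integrable[OF square_integrable_inner[of b]] by (simp add: inner_commute)
  then have "integrable P (\<lambda>\<omega>. \<Sum>b\<in>Basis. (x \<omega> \<bullet> b) *\<^sub>R b)" by simp
  then have "integrable P x" by (simp only: euclidean_representation)
  then show ?thesis using mean_zero by simp
qed

lemma expectation_component_mult: "(\<integral>\<omega>. x \<omega> $ k * x \<omega> $ l \<partial>P) = X $ k $ l"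
  using covariance mean_zero by (auto simp: covariance_matrix_def)

text \<open>The constant and the normal case merge into one formula in the second moment. Hence
  characteristic functions factorize as soon as second moments add.\<close>

lemma expectation_iexp_inner:
  "(\<integral>\<omega>. iexp (a \<bullet> x \<omega>) \<partial>P) = of_real (exp (- (\<integral>\<omega>. (a \<bullet> x \<omega>)\<^sup>2 \<partial>P) / 2))"
proof -
  consider c where "AE \<omega> in P. a \<bullet> x \<omega> = c"
    | c \<sigma> where "\<sigma> > 0" "distributed P lborel (\<lambda>\<omega>. a \<bullet> x \<omega>) (normal_density c \<sigma>)"
    using gaussian unfolding gaussian_vector_def by blast
  then show ?thesis
  proof cases
    case 1
    have "(\<integral>\<omega>. a \<bullet> x \<omega> \<partial>P) = (\<integral>\<omega>. c \<partial>P)" using 1 by (intro integral_cong_AE) auto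
    then have "c = 0" by (simp add: expectation_inner prob_space)
    with 1 have ae: "AE \<omega> in P. a \<bullet> x \<omega> = 0" by simp
    have "(\<integral>\<omega>. (a \<bullet> x \<omega>)\<^sup>2 \<partial>P) = (\<integral>\<omega>. 0 \<partial>P)" using ae by (intro integral_cong_AE) auto
    moreover have "(\<integral>\<omega>. iexp (a \<bullet> x \<omega>) \<partial>P) = (\<integral>\<omega>. 1 \<partial>P)" using ae by (intro integral_cong_AE) auto
    ultimately show ?thesis by (simp add: prob_space)
  next
    case 2
    note m = normal_distributed_moments[OF 2(2,1)]
    have "c = 0" using m(2) expectation_inner[of a] by simp
    then show ?thesis using m(3,4) by simp
  qed
qed

text \<open>
  The joint characteristic function factorizes, so the function
  \<^term>\<open>\<lambda>\<omega>. iexp (a \<bullet> x \<omega>) - (\<integral>\<omega>. iexp (a \<bullet> x \<omega>) \<partial>P)\<close> has vanishing Fourier transform along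
  \<^term>\<open>\<lambda>\<omega>. b \<bullet> x \<omega>\<close>.
\<close>

lemma uncorrelated_imp_expectation_mult_iexp:
  assumes unc: "(\<integral>\<omega>. (a \<bullet> x \<omega>) * (b \<bullet> x \<omega>) \<partial>P) = 0"
  shows "(\<integral>\<omega>. of_real (b \<bullet> x \<omega>) * iexp (a \<bullet> x \<omega>) \<partial>P) = 0"
proof -
  define \<phi> where "\<phi> = (\<integral>\<omega>. iexp (a \<bullet> x \<omega>) \<partial>P)"
  have iexp_int: "integrable P (\<lambda>\<omega>. iexp (c \<bullet> x \<omega>))" for c
    using integrable_mult_iexp[of P "\<lambda>_. 1" "\<lambda>\<omega>. c \<bullet> x \<omega>"] by simp
  have b: "integrable P (\<lambda>\<omega>. complex_of_real (b \<bullet> x \<omega>))"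
    using square_integrable_integrable[OF square_integrable_inner[of b]] by simp
  have b': "integrable P (\<lambda>\<omega>. of_real (b \<bullet> x \<omega>) * iexp (a \<bullet> x \<omega>))"
    by (rule integrable_mult_iexp[OF b]) simp
  \<comment> \<open>With the identity as \<open>g\<close>, the test function is
    \<open>b \<bullet> x\<close> itself. The term with \<open>\<phi>\<close> drops at the end
    because \<open>b \<bullet> x\<close> has mean zero.\<close>
  have "(\<integral>\<omega>. (iexp (a \<bullet> x \<omega>) - \<phi>) * of_real (b \<bullet> x \<omega>) \<partial>P) = 0"
  proof (rule integral_mult_eq_0_if_fourier_eq_0[where g = "\<lambda>y. y" and y = "\<lambda>\<omega>. b \<bullet> x \<omega>"])
    show "integrable P (\<lambda>\<omega>. iexp (a \<bullet> x \<omega>) - \<phi>)" using iexp_int by simp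
    show "integrable P (\<lambda>\<omega>. (iexp (a \<bullet> x \<omega>) - \<phi>) * of_real (b \<bullet> x \<omega>))"
      using b b' by (simp add: left_diff_distrib mult.commute[of "iexp _"] del: of_real_mult)
    fix t
    have sq: "(\<integral>\<omega>. ((a + t *\<^sub>R b) \<bullet> x \<omega>)\<^sup>2 \<partial>P) =
        (\<integral>\<omega>. (a \<bullet> x \<omega>)\<^sup>2 \<partial>P) + (\<integral>\<omega>. ((t *\<^sub>R b) \<bullet> x \<omega>)\<^sup>2 \<partial>P)"
    proof -
      have "((a + t *\<^sub>R b) \<bullet> x \<omega>)\<^sup>2 = (a \<bullet> x \<omega>)\<^sup>2 + ((t *\<^sub>R b) \<bullet> x \<omega>)\<^sup>2 + 2 * t * ((a \<bullet> x \<omega>) * (b \<bullet> x \<omega>))" for \<omega>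
        by (simp add: inner_add_left power2_eq_square algebra_simps)
      then show ?thesis
        using unc square_integrable_inner[of a] square_integrable_inner[of "t *\<^sub>R b"]
          square_integrable_mult[OF square_integrable_inner[of a] square_integrable_inner[of b]]
        by (simp add: square_integrable_def del: inner_scaleR_left)
    qed
    have "(\<integral>\<omega>. (iexp (a \<bullet> x \<omega>) - \<phi>) * iexp (t * (b \<bullet> x \<omega>)) \<partial>P) =
        (\<integral>\<omega>. iexp ((a + t *\<^sub>R b) \<bullet> x \<omega>) - \<phi> * iexp ((t *\<^sub>R b) \<bullet> x \<omega>) \<partial>P)"
      by (simp add: inner_add_left left_diff_distrib distrib_left exp_add)
    also have "\<dots> = (\<integral>\<omega>. iexp ((a + t *\<^sub>R b) \<bullet> x \<omega>) \<partial>P) - \<phi> * (\<integral>\<omega>. iexp ((t *\<^sub>R b) \<bullet> x \<omega>) \<partial>P)"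
      using iexp_int[of "a + t *\<^sub>R b"] iexp_int[of "t *\<^sub>R b"]
      by (subst Bochner_Integration.integral_diff) auto
    also have "\<dots> = 0"
      unfolding \<phi>_def expectation_iexp_inner sq
      by (simp only: of_real_mult[symmetric] exp_add[symmetric]) (simp add: add_divide_distrib)
    finally show "(\<integral>\<omega>. (iexp (a \<bullet> x \<omega>) - \<phi>) * iexp (t * (b \<bullet> x \<omega>)) \<partial>P) = 0" .
  qed simp_all
  also have "(\<integral>\<omega>. (iexp (a \<bullet> x \<omega>) - \<phi>) * of_real (b \<bullet> x \<omega>) \<partial>P) =
      (\<integral>\<omega>. of_real (b \<bullet> x \<omega>) * iexp (a \<bullet> x \<omega>) - \<phi> * of_real (b \<bullet> x \<omega>) \<partial>P)"
    by (simp add: algebra_simps)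
  also have "\<dots> = (\<integral>\<omega>. of_real (b \<bullet> x \<omega>) * iexp (a \<bullet> x \<omega>) \<partial>P) - \<phi> * of_real (\<integral>\<omega>. b \<bullet> x \<omega> \<partial>P)"
    using b b' by (subst Bochner_Integration.integral_diff) auto
  finally show ?thesis by (simp add: expectation_inner)
qed

text \<open>Gaussianity pays off here: vanishing correlation with each coordinate in
  \<open>J\<close> gives orthogonality to nonlinear functions of them as well. Every frequency
  vector on \<open>J\<close> is a direction \<open>a\<close> uncorrelated with \<open>b\<close> by
  linearity, so the weight \<open>b \<bullet> x\<close> has zero transform.\<close>

lemma uncorrelated_imp_expectation_mult:
  fixes J :: "'n set"
  defines "r \<equiv> \<lambda>\<omega>. restrict (\<lambda>k. x \<omega> $ k) J"
  assumes unc: "\<And>l. l \<in> J \<Longrightarrow> (\<integral>\<omega>. x \<omega> $ l * (b \<bullet> x \<omega>) \<partial>P) = 0"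
    and g: "g \<in> borel_measurable (\<Pi>\<^sub>M k\<in>J. borel)" "square_integrable P (\<lambda>\<omega>. g (r \<omega>))"
  shows "(\<integral>\<omega>. (b \<bullet> x \<omega>) * g (r \<omega>) \<partial>P) = 0"
proof (rule integral_mult_eq_0_if_fourier_eq_0_PiM[OF finite _ _ g(1)])
  show "integrable P (\<lambda>\<omega>. b \<bullet> x \<omega>)"
    by (rule square_integrable_integrable[OF square_integrable_inner])
  show "r \<in> P \<rightarrow>\<^sub>M (\<Pi>\<^sub>M k\<in>J. borel)" unfolding r_def by measurable
  show "integrable P (\<lambda>\<omega>. (b \<bullet> x \<omega>) * g (r \<omega>))"
    by (rule square_integrable_mult[OF square_integrable_inner g(2)])
  fix t :: "'n \<Rightarrow> real"
  define a where "a = (\<Sum>k\<in>J. t k *\<^sub>R axis k (1 :: real))"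
  have a: "a \<bullet> x \<omega> = (\<Sum>k\<in>J. t k * x \<omega> $ k)" for \<omega>
    by (simp add: a_def inner_sum_left inner_sum_right inner_diff_right cart_eq_inner_axis inner_commute)
  have "(\<integral>\<omega>. (a \<bullet> x \<omega>) * (b \<bullet> x \<omega>) \<partial>P) = (\<Sum>k\<in>J. t k * (\<integral>\<omega>. x \<omega> $ k * (b \<bullet> x \<omega>) \<partial>P))"
    using square_integrable_mult[OF square_integrable_component square_integrable_inner]
    by (simp add: a sum_distrib_right mult.assoc)
  then have "(\<integral>\<omega>. of_real (b \<bullet> x \<omega>) * iexp (a \<bullet> x \<omega>) \<partial>P) = 0"
    using unc by (intro uncorrelated_imp_expectation_mult_iexp) simp
  moreover have "(\<Sum>k\<in>J. t k * r \<omega> k) = a \<bullet> x \<omega>" for \<omega> by (simp add: a r_def)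
  ultimately show "(\<integral>\<omega>. of_real (b \<bullet> x \<omega>) * iexp (\<Sum>k\<in>J. t k * r \<omega> k) \<partial>P) = 0" by (simp only:)
qed

text \<open>
  A coordinate outside \<open>J\<close> is a linear combination of the coordinates in \<open>J\<close> plus a part that is
  uncorrelated with, hence independent of, the coordinates in \<open>J\<close>.
\<close>

lemma linear_projection_of_function:
  fixes J :: "'n set"
  defines "r \<equiv> \<lambda>\<omega>. restrict (\<lambda>k. x \<omega> $ k) J"
  assumes g: "g \<in> borel_measurable (\<Pi>\<^sub>M k\<in>J. borel)" "square_integrable P (\<lambda>\<omega>. g (r \<omega>))"
  shows "\<exists>c. (\<forall>l. l \<notin> J \<longrightarrow> c $ l = 0) \<and> (\<forall>j. (\<integral>\<omega>. (g (r \<omega>) - c \<bullet> x \<omega>) * x \<omega> $ j \<partial>P) = 0)"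
proof -
  have "finite J" by simp
  from L2_projection[where y = "\<lambda>k \<omega>. x \<omega> $ k", OF this square_integrable_component g(2)] obtain c where
    c: "\<And>l. l \<in> J \<Longrightarrow> (\<integral>\<omega>. (g (r \<omega>) - (\<Sum>k\<in>J. c k * x \<omega> $ k)) * x \<omega> $ l \<partial>P) = 0" by blast
  define c' :: "real^'n" where "c' = (\<chi> k. if k \<in> J then c k else 0)"
  have c': "c' \<bullet> x \<omega> = (\<Sum>k\<in>J. c k * x \<omega> $ k)" for \<omega>
    by (simp add: inner_vec_def c'_def if_distrib[of "\<lambda>u. u * _"] sum.If_cases)
  define e where "e \<omega> = g (r \<omega>) - c' \<bullet> x \<omega>" for \<omega>
  have e: "square_integrable P e" unfolding e_def[abs_def]
    by (rule square_integrable_diff[OF g(2) square_integrable_inner])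
  have e0: "(\<integral>\<omega>. e \<omega> * x \<omega> $ l \<partial>P) = 0" if "l \<in> J" for l
    using c[OF that] by (simp add: e_def c')
  \<comment> \<open>The residual \<open>e\<close> is again a function of the coordinates in
    \<open>J\<close>, namely \<open>g'\<close>, and can therefore serve as the test function
    below.\<close>
  define g' where "g' y = g y - (\<Sum>k\<in>J. c k * y k)" for y
  have g': "g' \<in> borel_measurable (\<Pi>\<^sub>M k\<in>J. borel)" unfolding g'_def[abs_def] using g(1) by measurable
  have eg': "e = (\<lambda>\<omega>. g' (restrict (\<lambda>k. x \<omega> $ k) J))"
    by (simp add: fun_eq_iff e_def c' g'_def r_def)
  have "(\<integral>\<omega>. e \<omega> * x \<omega> $ j \<partial>P) = 0" for j
  proof -
    from L2_projection[where y = "\<lambda>k \<omega>. x \<omega> $ k",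
        OF \<open>finite J\<close> square_integrable_component square_integrable_component[of j]] obtain d where
      d: "\<And>l. l \<in> J \<Longrightarrow> (\<integral>\<omega>. (x \<omega> $ j - (\<Sum>k\<in>J. d k * x \<omega> $ k)) * x \<omega> $ l \<partial>P) = 0" by blast
    \<comment> \<open>\<open>b \<bullet> x\<close> is the part of coordinate \<open>j\<close> not
      explained linearly by those in \<open>J\<close>; \<open>e\<close> is orthogonal to it by
      Gaussianity and to the explained part by the choice of \<open>c\<close>.\<close>
    define b where "b = axis j 1 - (\<Sum>k\<in>J. d k *\<^sub>R axis k (1 :: real))"
    have b: "b \<bullet> x \<omega> = x \<omega> $ j - (\<Sum>k\<in>J. d k * x \<omega> $ k)" for \<omega>
      by (simp add: b_def inner_diff_left inner_sum_left inner_sum_right inner_diff_right cart_eq_inner_axis inner_commute)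
    have be: "(\<integral>\<omega>. (b \<bullet> x \<omega>) * e \<omega> \<partial>P) = 0"
      unfolding eg'
    proof (intro uncorrelated_imp_expectation_mult g')
      show "(\<integral>\<omega>. x \<omega> $ l * (b \<bullet> x \<omega>) \<partial>P) = 0" if "l \<in> J" for l
        using d[OF that] by (simp add: b mult.commute)
      show "square_integrable P (\<lambda>\<omega>. g' (restrict (\<lambda>k. x \<omega> $ k) J))"
        using e by (simp only: eg')
    qed
    have "e \<omega> * x \<omega> $ j = (b \<bullet> x \<omega>) * e \<omega> + (\<Sum>k\<in>J. d k * (e \<omega> * x \<omega> $ k))" for \<omega>
      by (simp add: b algebra_simps sum_distrib_left)
    then have "(\<integral>\<omega>. e \<omega> * x \<omega> $ j \<partial>P) =
        (\<integral>\<omega>. (b \<bullet> x \<omega>) * e \<omega> \<partial>P) + (\<Sum>k\<in>J. d k * (\<integral>\<omega>. e \<omega> * x \<omega> $ k \<partial>P))"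
      using square_integrable_mult[OF square_integrable_inner e]
        square_integrable_mult[OF e square_integrable_component] by simp
    then show ?thesis using be e0 by simp
  qed
  then show ?thesis by (intro exI[of _ c']) (auto simp: c'_def e_def)
qed

end

section \<open>Quadratic costs of decisions\<close>

lemma sum_UNIV_Plus:
  "(\<Sum>k\<in>UNIV. f k) = (\<Sum>a\<in>UNIV. f (Inl a)) + (\<Sum>b\<in>UNIV. f (Inr b))"
  for f :: "'n::finite + 'm::finite \<Rightarrow> 'b::comm_monoid_add"
  using sum.Plus[of UNIV UNIV f] by (simp add: comp_def)

lemma inner_transpose_matrix_vector: "v \<bullet> (transpose A *v w) = w \<bullet> (A *v v)"
  for A :: "real^'n::finite^'m::finite"
  by (simp only: transpose_matrix_vector inner_commute[of v] dot_lmul_matrix)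

lemma stack_inner_sym_block:
  fixes x :: "real^'n::finite" and u :: "real^'m::finite"
  shows "stack x u \<bullet> (sym_block Q S R *v stack x u) = x \<bullet> (Q *v x) + 2 * (x \<bullet> (S *v u)) + u \<bullet> (R *v u)"
proof -
  have "stack x u \<bullet> (sym_block Q S R *v stack x u) =
      x \<bullet> (Q *v x) + x \<bullet> (S *v u) + (u \<bullet> (transpose S *v x) + u \<bullet> (R *v u))"
    unfolding inner_vec_def matrix_vector_mult_def
    by (simp add: sum_UNIV_Plus stack_def sym_block_def sum.distrib distrib_left del: transpose_matrix_vector)
  then show ?thesis by (simp only: inner_transpose_matrix_vector)
qed

text \<open>The constant is the minimum over the compact unit sphere of \<open>T\<close>, extended
  by homogeneity. It is needed for the form of \<open>R\<close> on the decision space and for the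
  second moment of \<open>K *v x\<close> on a space of matrices.\<close>

lemma pos_homogeneous_quadratic_lower_bound:
  fixes q :: "'v::euclidean_space \<Rightarrow> real"
  assumes "continuous_on UNIV q" "subspace T"
    and pos: "\<And>v. v \<in> T \<Longrightarrow> v \<noteq> 0 \<Longrightarrow> 0 < q v"
    and hom: "\<And>c v. q (c *\<^sub>R v) = c\<^sup>2 * q v"
  shows "\<exists>c>0. \<forall>v\<in>T. c * (norm v)\<^sup>2 \<le> q v"
proof (cases "T \<inter> sphere 0 1 = {}")
  case True
  have "v = 0" if "v \<in> T" for v
  proof (rule ccontr)
    assume "v \<noteq> 0"
    then have "(1 / norm v) *\<^sub>R v \<in> T \<inter> sphere 0 1" using that assms(2) by (simp add: subspace_scale)
    with True show False by blast
  qed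
  moreover have "q 0 = 0" using hom[of 0 0] by simp
  ultimately have "\<forall>v\<in>T. 1 * (norm v)\<^sup>2 \<le> q v" by (metis mult_zero_right norm_zero order_refl zero_power2)
  then show ?thesis by (intro exI[of _ 1]) simp
next
  case False
  have "compact (T \<inter> sphere 0 1)"
    using closed_subspace[OF assms(2)] by (intro closed_Int_compact) auto
  from continuous_attains_inf[OF this False continuous_on_subset[OF assms(1)]]
  obtain w where w: "w \<in> T" "norm w = 1" and min: "\<And>v. v \<in> T \<Longrightarrow> norm v = 1 \<Longrightarrow> q w \<le> q v"
    by (auto simp: sphere_def)
  have "q w * (norm v)\<^sup>2 \<le> q v" if "v \<in> T" for v
  proof (cases "v = 0")
    case True
    then show ?thesis using hom[of 0 v] by simp
  next
    case False
    have "q w \<le> q ((1 / norm v) *\<^sub>R v)"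
      using False that assms(2) by (intro min) (auto simp: subspace_scale)
    then show ?thesis using False by (simp add: hom power_divide field_simps)
  qed
  moreover have "0 < q w" using w by (intro pos) auto
  ultimately show ?thesis by blast
qed

text \<open>Half of the curvature \<open>c\<close> of \<open>R\<close> is spent on absorbing the
  mixed term, the other half remains. The bound yields both square integrability of decisions and
  coercivity of the linear problem.\<close>

lemma pd_mats_form_lower_bound:
  fixes Q :: "real^'n::finite^'n" and S :: "real^'m::finite^'n"
  assumes "R \<in> pd_mats"
  shows "\<exists>c C. 0 < c \<and> (\<forall>x u. c * (norm u)\<^sup>2 - C * (norm x)\<^sup>2 \<le> x \<bullet> (Q *v x) + 2 * (x \<bullet> (S *v u)) + u \<bullet> (R *v u))"
proof -
  have "\<exists>c>0. \<forall>u\<in>UNIV. c * (norm u)\<^sup>2 \<le> u \<bullet> (R *v u)"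
  proof (rule pos_homogeneous_quadratic_lower_bound)
    show "continuous_on UNIV (\<lambda>u. u \<bullet> (R *v u))"
      by (intro continuous_intros matrix_vector_mult_linear_continuous_on)
  qed (use assms in \<open>auto simp: pd_mats_def power2_eq_square matrix_vector_mult_scaleR\<close>)
  then obtain c where c: "0 < c" "\<And>u. c * (norm u)\<^sup>2 \<le> u \<bullet> (R *v u)" by auto
  obtain q where q: "\<And>x. norm (Q *v x) \<le> norm x * q"
    using bounded_linear.bounded[OF matrix_vector_mul_bounded_linear[of Q]] by blast
  obtain s where s: "\<And>u. norm (S *v u) \<le> norm u * s"
    using bounded_linear.bounded[OF matrix_vector_mul_bounded_linear[of S]] by blast
  have "c / 2 * (norm u)\<^sup>2 - (q + 2 * s\<^sup>2 / c) * (norm x)\<^sup>2 \<le> x \<bullet> (Q *v x) + 2 * (x \<bullet> (S *v u)) + u \<bullet> (R *v u)" for x u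
  proof -
    have "\<bar>x \<bullet> (Q *v x)\<bar> \<le> norm x * (norm x * q)"
      by (rule order_trans[OF Cauchy_Schwarz_ineq2]) (intro mult_left_mono q norm_ge_zero)
    moreover have "\<bar>x \<bullet> (S *v u)\<bar> \<le> norm x * (norm u * s)"
      by (rule order_trans[OF Cauchy_Schwarz_ineq2]) (intro mult_left_mono s norm_ge_zero)
    moreover have "2 * (norm x * (norm u * s)) \<le> c / 2 * (norm u)\<^sup>2 + 2 * s\<^sup>2 / c * (norm x)\<^sup>2"
    proof -
      \<comment> \<open>This square is the source of the constant
        \<open>2 * s\<^sup>2 / c\<close>.\<close>
      have "0 \<le> (c * norm u - 2 * s * norm x)\<^sup>2 / (2 * c)" using c(1) by simp
      also have "\<dots> = c / 2 * (norm u)\<^sup>2 + 2 * s\<^sup>2 / c * (norm x)\<^sup>2 - 2 * (norm x * (norm u * s))"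
        using c(1) by (simp add: power2_eq_square field_simps)
      finally show ?thesis by simp
    qed
    moreover have "norm x * (norm x * q) = q * (norm x)\<^sup>2" by (simp add: power2_eq_square)
    ultimately show ?thesis using c(2)[of u] unfolding distrib_right by linarith
  qed
  then show ?thesis using c(1) by (intro exI[of _ "c / 2"] exI[of _ "q + 2 * s\<^sup>2 / c"]) auto
qed

section \<open>Extended expectations, costs and coordinates of decisions\<close>

lemma ext_expectation_integrable:
  assumes "integrable P f"
  shows "ext_expectation P f = ereal (\<integral>\<omega>. f \<omega> \<partial>P)"
proof -
  have fin: "(\<integral>\<^sup>+\<omega>. ennreal (f \<omega>) \<partial>P) < \<top>" "(\<integral>\<^sup>+\<omega>. ennreal (- f \<omega>) \<partial>P) < \<top>"
    using assms by (auto simp: real_integrable_def less_top)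
  then show ?thesis
    unfolding ext_expectation_def real_lebesgue_integral_def[OF assms]
    by (cases "\<integral>\<^sup>+\<omega>. ennreal (f \<omega>) \<partial>P"; cases "\<integral>\<^sup>+\<omega>. ennreal (- f \<omega>) \<partial>P") auto
qed

text \<open>Nonnegativity rules out an expectation of minus infinity, which would also lie below
  \<open>\<infinity>\<close>.\<close>

lemma integrable_if_ext_expectation_less_top:
  assumes "f \<in> borel_measurable P" "\<And>\<omega>. 0 \<le> f \<omega>" "ext_expectation P f < \<infinity>"
  shows "integrable P f"
proof (rule integrableI_nonneg)
  have "(\<integral>\<^sup>+\<omega>. ennreal (- f \<omega>) \<partial>P) = (\<integral>\<^sup>+\<omega>. 0 \<partial>P)"
    using assms(2) by (intro nn_integral_cong) (simp add: ennreal_neg)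
  then have "enn2ereal (\<integral>\<^sup>+\<omega>. ennreal (f \<omega>) \<partial>P) < \<infinity>"
    using assms(3) by (simp add: ext_expectation_def zero_ennreal.rep_eq)
  then show "(\<integral>\<^sup>+\<omega>. ennreal (f \<omega>) \<partial>P) < \<infinity>"
    by (cases "\<integral>\<^sup>+\<omega>. ennreal (f \<omega>) \<partial>P") auto
qed (use assms in auto)

lemma inner_matrix_vector_expand:
  fixes A :: "real^'l::finite^'k::finite"
  shows "u \<bullet> (A *v v) = (\<Sum>a\<in>UNIV. \<Sum>b\<in>UNIV. A $ a $ b * (u $ a * v $ b))"
  by (simp add: inner_vec_def matrix_vector_mult_def sum_distrib_left ac_simps)

lemma expectation_bilinear_form:
  fixes A :: "real^'l::finite^'k::finite"
  assumes "\<And>a. square_integrable P (\<lambda>\<omega>. u \<omega> $ a)" "\<And>b. square_integrable P (\<lambda>\<omega>. v \<omega> $ b)"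
  shows "integrable P (\<lambda>\<omega>. u \<omega> \<bullet> (A *v v \<omega>))"
    and "(\<integral>\<omega>. u \<omega> \<bullet> (A *v v \<omega>) \<partial>P) = (\<Sum>a\<in>UNIV. \<Sum>b\<in>UNIV. A $ a $ b * (\<integral>\<omega>. u \<omega> $ a * v \<omega> $ b \<partial>P))"
  unfolding inner_matrix_vector_expand using square_integrable_mult[OF assms] by simp_all

text \<open>The entrywise (Frobenius) inner product of \<open>X\<close> with the matrix of the
  quadratic form obtained by inserting u = K x. No probability space occurs in it, so a minimizer
  can be chosen from \<open>X\<close> alone.\<close>

definition linear_cost :: "real^'n^'n \<Rightarrow> real^'m^'n \<Rightarrow> real^'m^'m \<Rightarrow> real^'n^'n \<Rightarrow> real^'n^'m \<Rightarrow> real" where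
  "linear_cost Q S R X K =
     (\<Sum>a\<in>UNIV. \<Sum>b\<in>UNIV. (Q + 2 *\<^sub>R (S ** K) + transpose K ** R ** K) $ a $ b * X $ a $ b)"

lemma continuous_on_linear_cost:
  fixes S :: "real^'m::finite^'n::finite"
  shows "continuous_on U (linear_cost Q S R X)"
  unfolding linear_cost_def[abs_def] matrix_matrix_mult_def transpose_def
  by (simp, intro continuous_intros)

lemma subspace_block_diag: "subspace (block_diag bx bu)"
  by (auto simp: subspace_def block_diag_def)

lemma block_diag_decision:
  assumes "K \<in> block_diag bx bu"
  shows "(\<lambda>\<xi>. K *v \<xi>) \<in> decisions bx bu"
proof -
  \<comment> \<open>\<open>restrict\<close> makes the value extensional, as the product space
    \<open>block_space bu i\<close> requires.\<close>
  define \<nu> where "\<nu> i \<xi> = restrict (\<lambda>k. \<Sum>l\<in>block bx i. K $ k $ l * \<xi> l) (block bu i)" for i and \<xi> :: "_ \<Rightarrow> real"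
  have "subvec bu i (K *v \<xi>) = \<nu> i (subvec bx i \<xi>)" for i \<xi>
  proof -
    have "(\<Sum>l\<in>UNIV. K $ k $ l * \<xi> $ l) = (\<Sum>l\<in>block bx (bu k). K $ k $ l * \<xi> $ l)" for k
      using assms by (intro sum.mono_neutral_right) (auto simp: block_diag_def block_def)
    then show ?thesis
      by (auto simp: subvec_def \<nu>_def matrix_vector_mult_def block_def fun_eq_iff)
  qed
  moreover have "\<nu> i \<in> block_space bx i \<rightarrow>\<^sub>M block_space bu i" for i
    unfolding \<nu>_def[abs_def] block_space_def by measurable
  ultimately show ?thesis unfolding decisions_def by blast
qed

text \<open>Projection works on scalar functions, so a decision is split into coordinates, each a
  measurable function of the subvector seen by its owner.\<close>

lemma decisions_component:
  assumes "\<mu> \<in> decisions bx bu"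
  obtains g where "g \<in> borel_measurable (\<Pi>\<^sub>M l\<in>block bx (bu k). borel)"
    "\<And>\<xi>. \<mu> \<xi> $ k = g (restrict (\<lambda>l. \<xi> $ l) (block bx (bu k)))"
proof -
  from assms obtain \<nu> where \<nu>: "\<And>i. \<nu> i \<in> block_space bx i \<rightarrow>\<^sub>M block_space bu i"
    "\<And>i \<xi>. subvec bu i (\<mu> \<xi>) = \<nu> i (subvec bx i \<xi>)" unfolding decisions_def by blast
  have k: "k \<in> block bu (bu k)" by (simp add: block_def)
  show thesis
  proof
    show "(\<lambda>y. \<nu> (bu k) y k) \<in> borel_measurable (\<Pi>\<^sub>M l\<in>block bx (bu k). borel)"
      using measurable_compose[OF \<nu>(1)[unfolded block_space_def] measurable_component_singleton[OF k]] .
    show "\<mu> \<xi> $ k = \<nu> (bu k) (restrict (\<lambda>l. \<xi> $ l) (block bx (bu k))) k" for \<xi>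
      using fun_cong[OF \<nu>(2)[of "bu k" \<xi>], of k] k by (simp add: subvec_def)
  qed
qed

section \<open>Linear projection of decisions and the best linear decision\<close>

context centered_gaussian
begin

lemma square_integrable_matrix_component: "square_integrable P (\<lambda>\<omega>. (K *v x \<omega>) $ k)"
  unfolding matrix_vector_mult_def
  by (simp add: square_integrable_sum square_integrable_scale square_integrable_component)

lemma integrable_norm_matrix: "integrable P (\<lambda>\<omega>. (norm (K *v x \<omega>))\<^sup>2)"
  using expectation_bilinear_form(1)[where A = "mat 1",
    OF square_integrable_matrix_component[of K] square_integrable_matrix_component[of K]]
  by (simp add: power2_norm_eq_inner)

text \<open>This covers indefinite matrices: all products of coordinates are integrable, so positive
  and negative parts are finite and the convention for undefined expectations does not
  intervene.\<close>

lemma quad_cost_square_integrable: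
  fixes Q :: "real^'n^'n" and S :: "real^'m::finite^'n"
  assumes "\<And>k. square_integrable P (\<lambda>\<omega>. \<mu> (x \<omega>) $ k)"
  shows "integrable P (\<lambda>\<omega>. x \<omega> \<bullet> (Q *v x \<omega>) + 2 * (x \<omega> \<bullet> (S *v \<mu> (x \<omega>))) + \<mu> (x \<omega>) \<bullet> (R *v \<mu> (x \<omega>)))"
    and "quad_cost P x (sym_block Q S R) \<mu> =
      ereal (\<integral>\<omega>. x \<omega> \<bullet> (Q *v x \<omega>) + 2 * (x \<omega> \<bullet> (S *v \<mu> (x \<omega>))) + \<mu> (x \<omega>) \<bullet> (R *v \<mu> (x \<omega>)) \<partial>P)"
proof -
  show *: "integrable P (\<lambda>\<omega>. x \<omega> \<bullet> (Q *v x \<omega>) + 2 * (x \<omega> \<bullet> (S *v \<mu> (x \<omega>))) + \<mu> (x \<omega>) \<bullet> (R *v \<mu> (x \<omega>)))"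
    using assms square_integrable_component
    by (intro Bochner_Integration.integrable_add integrable_mult_right expectation_bilinear_form)
  show "quad_cost P x (sym_block Q S R) \<mu> =
      ereal (\<integral>\<omega>. x \<omega> \<bullet> (Q *v x \<omega>) + 2 * (x \<omega> \<bullet> (S *v \<mu> (x \<omega>))) + \<mu> (x \<omega>) \<bullet> (R *v \<mu> (x \<omega>)) \<partial>P)"
    unfolding quad_cost_def stack_inner_sym_block by (rule ext_expectation_integrable[OF *])
qed

lemma linear_cost_eq_expectation:
  "linear_cost Q S R X K = (\<integral>\<omega>. x \<omega> \<bullet> (Q *v x \<omega>) + 2 * (x \<omega> \<bullet> (S *v (K *v x \<omega>))) + (K *v x \<omega>) \<bullet> (R *v (K *v x \<omega>)) \<partial>P)"
proof -
  have "x \<omega> \<bullet> (Q *v x \<omega>) + 2 * (x \<omega> \<bullet> (S *v (K *v x \<omega>))) + (K *v x \<omega>) \<bullet> (R *v (K *v x \<omega>)) =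
      x \<omega> \<bullet> ((Q + 2 *\<^sub>R (S ** K) + transpose K ** R ** K) *v x \<omega>)" for \<omega>
  proof -
    have "(K *v x \<omega>) \<bullet> (R *v (K *v x \<omega>)) = x \<omega> \<bullet> (transpose K *v (R *v (K *v x \<omega>)))"
      by (simp only: inner_transpose_matrix_vector inner_commute)
    then show ?thesis
      by (simp add: matrix_vector_mult_add_rdistrib inner_add_right scaleR_matrix_vector_assoc[symmetric]
          matrix_vector_mul_assoc matrix_mul_assoc)
  qed
  then show ?thesis
    by (simp only: expectation_bilinear_form(2)[OF square_integrable_component square_integrable_component]
        expectation_component_mult linear_cost_def)
qed

lemma quad_cost_linear:
  "quad_cost P x (sym_block Q S R) (\<lambda>\<xi>. K *v \<xi>) = ereal (linear_cost Q S R X K)"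
  unfolding linear_cost_eq_expectation
  by (rule quad_cost_square_integrable(2)) (rule square_integrable_matrix_component)

text \<open>Row \<open>k\<close> of the matrix projects coordinate \<open>k\<close> of the decision.
  It is supported on the block its owner sees, hence the block structure, while the residual is
  orthogonal to all coordinates of \<open>x\<close>, also to those the owner does not see.\<close>

lemma decision_linear_projection:
  assumes \<mu>: "\<mu> \<in> decisions bx bu" and sq: "\<And>k. square_integrable P (\<lambda>\<omega>. \<mu> (x \<omega>) $ k)"
  shows "\<exists>K\<in>block_diag bx bu. \<forall>k l. (\<integral>\<omega>. (\<mu> (x \<omega>) - K *v x \<omega>) $ k * x \<omega> $ l \<partial>P) = 0"
proof -
  have "\<exists>c. (\<forall>l. l \<notin> block bx (bu k) \<longrightarrow> c $ l = 0) \<and> (\<forall>j. (\<integral>\<omega>. (\<mu> (x \<omega>) $ k - c \<bullet> x \<omega>) * x \<omega> $ j \<partial>P) = 0)" for k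
  proof -
    obtain g where g: "g \<in> borel_measurable (\<Pi>\<^sub>M l\<in>block bx (bu k). borel)"
      "\<And>\<xi>. \<mu> \<xi> $ k = g (restrict (\<lambda>l. \<xi> $ l) (block bx (bu k)))"
      using decisions_component[OF \<mu>] by blast
    show ?thesis
      using linear_projection_of_function[OF g(1)] sq[of k] unfolding g(2) by blast
  qed
  then have "\<forall>k. \<exists>c. (\<forall>l. l \<notin> block bx (bu k) \<longrightarrow> c $ l = 0) \<and> (\<forall>j. (\<integral>\<omega>. (\<mu> (x \<omega>) $ k - c \<bullet> x \<omega>) * x \<omega> $ j \<partial>P) = 0)"
    by (rule allI)
  from choice[OF this] obtain c where c: "\<And>k l. l \<notin> block bx (bu k) \<Longrightarrow> c k $ l = 0"
    "\<And>k j. (\<integral>\<omega>. (\<mu> (x \<omega>) $ k - c k \<bullet> x \<omega>) * x \<omega> $ j \<partial>P) = 0" by blast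
  show ?thesis
  proof
    show "(\<chi> k. c k) \<in> block_diag bx bu" using c(1) by (auto simp: block_diag_def block_def)
    show "\<forall>k l. (\<integral>\<omega>. (\<mu> (x \<omega>) - (\<chi> k. c k) *v x \<omega>) $ k * x \<omega> $ l \<partial>P) = 0"
      using c(2) by (simp add: matrix_vector_mul_component)
  qed
qed

lemma quad_cost_linear_le:
  fixes Q :: "real^'n^'n" and S :: "real^'m::finite^'n"
  assumes R: "R \<in> psd_mats" and sq: "\<And>k. square_integrable P (\<lambda>\<omega>. \<mu> (x \<omega>) $ k)"
    and orth: "\<And>k l. (\<integral>\<omega>. (\<mu> (x \<omega>) - K *v x \<omega>) $ k * x \<omega> $ l \<partial>P) = 0"
  shows "ereal (linear_cost Q S R X K) \<le> quad_cost P x (sym_block Q S R) \<mu>"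
proof -
  define e where "e \<omega> = \<mu> (x \<omega>) - K *v x \<omega>" for \<omega>
  have e: "square_integrable P (\<lambda>\<omega>. e \<omega> $ k)" for k
    unfolding e_def using square_integrable_diff[OF sq square_integrable_matrix_component] by simp
  \<comment> \<open>\<open>A\<close> collects the terms linear in \<open>e\<close>, the symmetry of
    \<open>R\<close> merging the two that involve \<open>K *v x\<close>. Being bilinear in
    \<open>e\<close> and \<open>x\<close>, they vanish in expectation by
    \<open>orth\<close>.\<close>
  define A where "A = 2 *\<^sub>R (transpose S + R ** K)"
  let ?F = "\<lambda>u \<omega>. x \<omega> \<bullet> (Q *v x \<omega>) + 2 * (x \<omega> \<bullet> (S *v u)) + u \<bullet> (R *v u)"
  have sym: "v \<bullet> (R *v w) = w \<bullet> (R *v v)" for v w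
    using R inner_transpose_matrix_vector[of v R w] by (simp add: psd_mats_def sym_mats_def del: transpose_matrix_vector)
  have F: "?F (\<mu> (x \<omega>)) \<omega> = ?F (K *v x \<omega>) \<omega> + e \<omega> \<bullet> (A *v x \<omega>) + e \<omega> \<bullet> (R *v e \<omega>)" for \<omega>
  proof -
    have "\<mu> (x \<omega>) = K *v x \<omega> + e \<omega>" by (simp add: e_def)
    moreover have "e \<omega> \<bullet> (A *v x \<omega>) = 2 * (x \<omega> \<bullet> (S *v e \<omega>)) + 2 * (e \<omega> \<bullet> (R *v (K *v x \<omega>)))"
      by (simp add: A_def matrix_vector_mult_add_rdistrib inner_add_right inner_transpose_matrix_vector
          scaleR_matrix_vector_assoc[symmetric] matrix_vector_mul_assoc del: transpose_matrix_vector)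
    ultimately show ?thesis
      using sym[of "K *v x \<omega>" "e \<omega>"]
      by (simp add: matrix_vector_right_distrib inner_add_left inner_add_right)
  qed
  have i: "integrable P (\<lambda>\<omega>. ?F (K *v x \<omega>) \<omega>)" "integrable P (\<lambda>\<omega>. e \<omega> \<bullet> (A *v x \<omega>))"
    "integrable P (\<lambda>\<omega>. e \<omega> \<bullet> (R *v e \<omega>))"
    using quad_cost_square_integrable(1)[of "\<lambda>\<xi>. K *v \<xi>", OF square_integrable_matrix_component]
      expectation_bilinear_form(1)[OF e square_integrable_component] expectation_bilinear_form(1)[OF e e] by auto
  have "(\<integral>\<omega>. ?F (\<mu> (x \<omega>)) \<omega> \<partial>P) = (\<integral>\<omega>. ?F (K *v x \<omega>) \<omega> \<partial>P) + (\<integral>\<omega>. e \<omega> \<bullet> (A *v x \<omega>) \<partial>P) + (\<integral>\<omega>. e \<omega> \<bullet> (R *v e \<omega>) \<partial>P)"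
    unfolding F
    by (simp only: Bochner_Integration.integral_add[OF Bochner_Integration.integrable_add[OF i(1,2)] i(3)]
      Bochner_Integration.integral_add[OF i(1,2)])
  moreover have "(\<integral>\<omega>. e \<omega> \<bullet> (A *v x \<omega>) \<partial>P) = 0"
  proof -
    have "(\<integral>\<omega>. e \<omega> $ k * x \<omega> $ l \<partial>P) = 0" for k l using orth by (simp only: e_def)
    then show ?thesis by (simp add: expectation_bilinear_form(2)[OF e square_integrable_component])
  qed
  moreover have "0 \<le> (\<integral>\<omega>. e \<omega> \<bullet> (R *v e \<omega>) \<partial>P)"
    using R by (intro integral_nonneg_AE) (auto simp: psd_mats_def)
  ultimately show ?thesis
    unfolding quad_cost_square_integrable(2)[OF sq] linear_cost_eq_expectation by simp
qed

text \<open>Semidefiniteness of the whole block matrix makes the integrand of a cost below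
  \<open>\<infinity>\<close> integrable; definiteness of \<open>R\<close> then bounds the squared
  decision by a linear combination of this integrand and the squared norm of
  \<open>x\<close>.\<close>

lemma square_integrable_if_quad_cost_finite:
  fixes Q :: "real^'n^'n" and S :: "real^'m::finite^'n"
  assumes psd: "sym_block Q S R \<in> psd_mats" and R: "R \<in> pd_mats"
    and \<mu>: "\<mu> \<in> decisions bx bu" and fin: "quad_cost P x (sym_block Q S R) \<mu> < \<infinity>"
  shows "square_integrable P (\<lambda>\<omega>. \<mu> (x \<omega>) $ k)"
proof -
  have comp [measurable]: "(\<lambda>\<omega>. \<mu> (x \<omega>) $ k) \<in> borel_measurable P" for k
  proof -
    obtain g where g: "g \<in> borel_measurable (\<Pi>\<^sub>M l\<in>block bx (bu k). borel)"
      "\<And>\<xi>. \<mu> \<xi> $ k = g (restrict (\<lambda>l. \<xi> $ l) (block bx (bu k)))"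
      using decisions_component[OF \<mu>] by blast
    show ?thesis unfolding g(2) by (rule measurable_compose[OF _ g(1)]) measurable
  qed
  define f where "f \<omega> = stack (x \<omega>) (\<mu> (x \<omega>)) \<bullet> (sym_block Q S R *v stack (x \<omega>) (\<mu> (x \<omega>)))" for \<omega>
  have [measurable]: "f \<in> borel_measurable P"
    unfolding f_def[abs_def] stack_inner_sym_block unfolding inner_matrix_vector_expand by measurable
  have f: "integrable P f"
  proof (rule integrable_if_ext_expectation_less_top)
    show "0 \<le> f \<omega>" for \<omega> using psd by (simp add: f_def psd_mats_def)
    show "ext_expectation P f < \<infinity>" using fin unfolding quad_cost_def f_def[abs_def] .
  qed measurable
  obtain c C where c: "0 < c" and
    le: "\<And>x u. c * (norm u)\<^sup>2 - C * (norm x)\<^sup>2 \<le> x \<bullet> (Q *v x) + 2 * (x \<bullet> (S *v u)) + u \<bullet> (R *v u)"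
    using pd_mats_form_lower_bound[OF R] by blast
  have nx: "integrable P (\<lambda>\<omega>. (norm (x \<omega>))\<^sup>2)"
    using integrable_norm_matrix[of "mat 1"] by simp
  have "integrable P (\<lambda>\<omega>. (\<mu> (x \<omega>) $ k)\<^sup>2)"
  proof (rule Bochner_Integration.integrable_bound)
    show "integrable P (\<lambda>\<omega>. (f \<omega> + C * (norm (x \<omega>))\<^sup>2) / c)" using f nx by simp
    have "norm ((\<mu> (x \<omega>) $ k)\<^sup>2) \<le> norm ((f \<omega> + C * (norm (x \<omega>))\<^sup>2) / c)" for \<omega>
    proof -
      have "(\<mu> (x \<omega>) $ k)\<^sup>2 \<le> (norm (\<mu> (x \<omega>)))\<^sup>2"
        using component_le_norm_cart[of "\<mu> (x \<omega>)" k] by (simp flip: abs_le_square_iff)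
      also have "\<dots> \<le> (f \<omega> + C * (norm (x \<omega>))\<^sup>2) / c"
        using le[of "\<mu> (x \<omega>)" "x \<omega>"] c by (simp add: f_def stack_inner_sym_block field_simps)
      also have "\<dots> \<le> \<bar>(f \<omega> + C * (norm (x \<omega>))\<^sup>2) / c\<bar>" by (rule abs_ge_self)
      finally show ?thesis by (simp only: real_norm_def abs_of_nonneg[OF zero_le_power2])
    qed
    then show "AE \<omega> in P. norm ((\<mu> (x \<omega>) $ k)\<^sup>2) \<le> norm ((f \<omega> + C * (norm (x \<omega>))\<^sup>2) / c)"
      by (rule AE_I2)
  qed measurable
  then show ?thesis by (simp add: square_integrable_def)
qed

text \<open>
  The costs of a linear decision \<open>K\<close> only depend on \<open>K *v x \<omega>\<close> up to null sets. On the orthogonal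
  complement of the matrices with \<open>K *v x \<omega> = 0\<close> almost surely, the objective is coercive.
\<close>

lemma linear_cost_attains_min:
  fixes Q :: "nat \<Rightarrow> real^'n^'n" and S :: "nat \<Rightarrow> real^'m::finite^'n"
  assumes R: "R 0 \<in> pd_mats" and K0: "K0 \<in> block_diag bx bu"
    "\<And>j. j \<in> J \<Longrightarrow> linear_cost (Q j) (S j) (R j) X K0 \<le> \<gamma> j"
  shows "\<exists>K\<in>block_diag bx bu. (\<forall>j\<in>J. linear_cost (Q j) (S j) (R j) X K \<le> \<gamma> j) \<and>
    (\<forall>K'\<in>block_diag bx bu. (\<forall>j\<in>J. linear_cost (Q j) (S j) (R j) X K' \<le> \<gamma> j) \<longrightarrow>
      linear_cost (Q 0) (S 0) (R 0) X K \<le> linear_cost (Q 0) (S 0) (R 0) X K')"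
proof -
  let ?B = "block_diag bx bu"
  let ?L = "\<lambda>j. linear_cost (Q j) (S j) (R j) X"
  \<comment> \<open>All costs are constant along \<open>N\<close>, so minimizing sequences could
    escape in these directions. \<open>N\<close> can be nonzero only if some block of
    \<open>x\<close> has singular covariance.\<close>
  define N where "N = {K \<in> ?B. AE \<omega> in P. K *v x \<omega> = 0}"
  have N: "subspace N"
  proof (rule subspaceI)
    show "0 \<in> N" using subspace_0[OF subspace_block_diag] by (simp add: N_def)
    fix K L assume K: "K \<in> N" and L: "L \<in> N"
    then have "AE \<omega> in P. K *v x \<omega> = 0" "AE \<omega> in P. L *v x \<omega> = 0" by (auto simp: N_def)
    then have "AE \<omega> in P. (K + L) *v x \<omega> = 0"
      by eventually_elim (simp add: matrix_vector_mult_add_rdistrib)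
    then show "K + L \<in> N" using K L subspace_add[OF subspace_block_diag] by (auto simp: N_def)
  next
    fix c :: real and K assume K: "K \<in> N"
    then have "AE \<omega> in P. K *v x \<omega> = 0" by (auto simp: N_def)
    then have "AE \<omega> in P. (c *\<^sub>R K) *v x \<omega> = 0"
      by eventually_elim (simp add: scaleR_matrix_vector_assoc[symmetric])
    then show "c *\<^sub>R K \<in> N" using K subspace_scale[OF subspace_block_diag] by (auto simp: N_def)
  qed
  define T where "T = {K \<in> ?B. \<forall>K'\<in>N. orthogonal K' K}"
  have T: "subspace T"
    unfolding T_def using subspace_block_diag[of bx bu]
    by (auto simp: subspace_def orthogonal_def inner_add_right)
  have repr: "\<exists>K'\<in>T. \<forall>j. ?L j K' = ?L j K" if "K \<in> ?B" for K
  proof -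
    obtain y z where yz: "y \<in> span N" "\<And>w. w \<in> span N \<Longrightarrow> orthogonal z w" "K = y + z"
      using orthogonal_subspace_decomp_exists by blast
    have "y \<in> N" using yz(1) N by (simp only: span_eq_iff[THEN iffD2])
    then have y: "y \<in> ?B" "AE \<omega> in P. y *v x \<omega> = 0" by (auto simp: N_def)
    have "z = K - y" using yz by simp
    then have "z \<in> ?B" using that y(1) subspace_diff[OF subspace_block_diag, of K bx bu y] by simp
    moreover have "orthogonal K' z" if "K' \<in> N" for K'
      using yz(2)[OF span_base[OF that]] by (simp only: orthogonal_commute[of K'])
    ultimately have "z \<in> T" by (simp add: T_def)
    moreover have "?L j z = ?L j K" for j
      unfolding linear_cost_eq_expectation
    proof (rule integral_cong_AE)
      show "AE \<omega> in P. x \<omega> \<bullet> (Q j *v x \<omega>) + 2 * (x \<omega> \<bullet> (S j *v (z *v x \<omega>))) + (z *v x \<omega>) \<bullet> (R j *v (z *v x \<omega>)) =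
          x \<omega> \<bullet> (Q j *v x \<omega>) + 2 * (x \<omega> \<bullet> (S j *v (K *v x \<omega>))) + (K *v x \<omega>) \<bullet> (R j *v (K *v x \<omega>))"
        using y(2) by eventually_elim (simp add: yz(3) matrix_vector_mult_add_rdistrib)
    qed (intro borel_measurable_integrable quad_cost_square_integrable(1) square_integrable_matrix_component)+
    ultimately show ?thesis by blast
  qed
  \<comment> \<open>The second moment of \<open>K *v x\<close> is itself a linear cost, so its
    continuity is already known.\<close>
  define s where "s = linear_cost 0 0 (mat 1 :: real^'m^'m) X"
  have s: "s K = (\<integral>\<omega>. (norm (K *v x \<omega>))\<^sup>2 \<partial>P)" for K
    by (simp add: s_def linear_cost_eq_expectation power2_norm_eq_inner)
  have "\<exists>c>0. \<forall>K\<in>T. c * (norm K)\<^sup>2 \<le> s K"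
  proof (rule pos_homogeneous_quadratic_lower_bound[OF _ T])
    show "continuous_on UNIV s" unfolding s_def by (rule continuous_on_linear_cost)
    show "s (c *\<^sub>R K) = c\<^sup>2 * s K" for c K
      by (simp add: s scaleR_matrix_vector_assoc[symmetric] power_mult_distrib)
    show "0 < s K" if "K \<in> T" "K \<noteq> 0" for K
    proof (rule ccontr)
      assume "\<not> 0 < s K"
      moreover have "0 \<le> s K" unfolding s by (intro integral_nonneg_AE) simp
      ultimately have "s K = 0" by simp
      then have "AE \<omega> in P. (norm (K *v x \<omega>))\<^sup>2 = 0"
        unfolding s using integrable_norm_matrix[of K] by (subst (asm) integral_nonneg_eq_0_iff_AE) auto
      then have "K \<in> N" using that(1) by (simp add: N_def T_def)
      then have "orthogonal K K" using that(1) by (simp add: T_def)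
      with that(2) show False by (simp add: orthogonal_self)
    qed
  qed
  then obtain d where d: "0 < d" "\<And>K. K \<in> T \<Longrightarrow> d * (norm K)\<^sup>2 \<le> s K" by blast
  obtain c C where c: "0 < c" and
    le: "\<And>x u. c * (norm u)\<^sup>2 - C * (norm x)\<^sup>2 \<le> x \<bullet> (Q 0 *v x) + 2 * (x \<bullet> (S 0 *v u)) + u \<bullet> (R 0 *v u)"
    using pd_mats_form_lower_bound[OF R] by blast
  define V where "V = (\<integral>\<omega>. (norm (x \<omega>))\<^sup>2 \<partial>P)"
  have nx: "integrable P (\<lambda>\<omega>. (norm (x \<omega>))\<^sup>2)" using integrable_norm_matrix[of "mat 1"] by simp
  have coercive: "c * d * (norm K)\<^sup>2 - C * V \<le> ?L 0 K" if "K \<in> T" for K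
  proof -
    have "c * d * (norm K)\<^sup>2 - C * V \<le> c * s K - C * V"
      using d(2)[OF that] c by simp
    also have "\<dots> = (\<integral>\<omega>. c * (norm (K *v x \<omega>))\<^sup>2 - C * (norm (x \<omega>))\<^sup>2 \<partial>P)"
      using integrable_norm_matrix[of K] nx by (simp add: s V_def)
    also have "\<dots> \<le> ?L 0 K"
      unfolding linear_cost_eq_expectation using integrable_norm_matrix[of K] nx le
      by (intro integral_mono quad_cost_square_integrable(1) square_integrable_matrix_component) auto
    finally show ?thesis .
  qed
  obtain K1 where K1: "K1 \<in> T" "\<And>j. ?L j K1 = ?L j K0" using repr[OF K0(1)] by blast
  \<comment> \<open>Cutting at the value of \<open>K0\<close> makes the feasible part of
    \<open>T\<close> bounded by coercivity; whatever is cut away is worse than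
    \<open>K0\<close>.\<close>
  define D where "D = T \<inter> (\<Inter>j\<in>J. {K. ?L j K \<le> \<gamma> j}) \<inter> {K. ?L 0 K \<le> ?L 0 K0}"
  have "closed D"
    unfolding D_def using closed_subspace[OF T]
    by (intro closed_Int closed_INT ballI closed_Collect_le continuous_on_linear_cost continuous_on_const) auto
  moreover have "bounded D"
  proof (rule boundedI)
    fix K assume "K \<in> D"
    then have "c * d * (norm K)\<^sup>2 \<le> ?L 0 K0 + C * V" using coercive[of K] by (auto simp: D_def)
    then have "(norm K)\<^sup>2 \<le> (?L 0 K0 + C * V) / (c * d)" using c d(1) by (simp add: field_simps)
    then show "norm K \<le> sqrt ((?L 0 K0 + C * V) / (c * d))" by (rule real_le_rsqrt)
  qed
  ultimately have "compact D" by (simp add: compact_eq_bounded_closed)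
  moreover have "K1 \<in> D" using K1 K0 by (auto simp: D_def)
  ultimately obtain K where K: "K \<in> D" "\<And>K'. K' \<in> D \<Longrightarrow> ?L 0 K \<le> ?L 0 K'"
    using continuous_attains_inf[OF _ _ continuous_on_linear_cost] by (metis empty_iff)
  show ?thesis
  proof (intro bexI conjI ballI impI)
    show "?L j K \<le> \<gamma> j" if "j \<in> J" for j using K(1) that by (auto simp: D_def)
    show "K \<in> ?B" using K(1) by (auto simp: D_def T_def)
    fix K' assume K': "K' \<in> ?B" "\<forall>j\<in>J. ?L j K' \<le> \<gamma> j"
    obtain K2 where K2: "K2 \<in> T" "\<And>j. ?L j K2 = ?L j K'" using repr[OF K'(1)] by blast
    show "?L 0 K \<le> ?L 0 K'"
    proof (cases "?L 0 K' \<le> ?L 0 K0")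
      case True
      then have "K2 \<in> D" using K2 K'(2) by (auto simp: D_def)
      then show ?thesis using K(2) K2(2) by metis
    next
      case False
      then show ?thesis using K(1) by (auto simp: D_def)
    qed
  qed
qed

end

section \<open>Optimality among all decisions, uniformly in the probability space\<close>

lemma pd_mats_subset_psd_mats: "pd_mats \<subseteq> psd_mats"
  by (auto simp: pd_mats_def psd_mats_def) (metis inner_zero_left less_eq_real_def)

theorem theorem2:
  fixes bx :: "'n::finite \<Rightarrow> 'd::finite" and bu :: "'m::finite \<Rightarrow> 'd"
    and Q :: "nat \<Rightarrow> real^'n^'n" and S :: "nat \<Rightarrow> real^'m^'n" and R :: "nat \<Rightarrow> real^'m^'m"
    and \<gamma> :: "nat \<Rightarrow> real" and M :: nat and X :: "real^'n^'n"
    and W :: "nat \<Rightarrow> real^('n + 'm)^('n + 'm)"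
  assumes "surj bx" and "surj bu"
    and W: "\<And>j. W j = sym_block (Q j) (S j) (R j)"
    and "W 0 \<in> psd_mats" and "R 0 \<in> pd_mats"
    and "\<And>j. j \<in> {1..M} \<Longrightarrow> W j \<in> sym_mats" and "\<And>j. j \<in> {1..M} \<Longrightarrow> R j \<in> psd_mats"
  shows "\<exists>K \<in> block_diag bx bu. \<forall>(P :: 'a measure) x.
     prob_space P \<longrightarrow> gaussian_vector P x \<longrightarrow> integral\<^sup>L P x = 0 \<longrightarrow> covariance_matrix P x = X \<longrightarrow>
     feasible P x bx bu M W \<gamma> \<longrightarrow> optimal P x bx bu M W \<gamma> (\<lambda>\<xi>. K *v \<xi>)"
proof -
  let ?B = "block_diag bx bu"
  let ?L = "\<lambda>j. linear_cost (Q j) (S j) (R j) X"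
  let ?lin = "\<lambda>K. K \<in> ?B \<and> (\<forall>j\<in>{1..M}. ?L j K \<le> \<gamma> j)"
  have psd: "sym_block (Q 0) (S 0) (R 0) \<in> psd_mats" using assms(4) by (simp add: W)
  have Rpsd: "R j \<in> psd_mats" if "j = 0 \<or> j \<in> {1..M}" for j
    using that assms(5,7) pd_mats_subset_psd_mats by auto
  \<comment> \<open>Feasibility and cost of the linear replacement refer to \<open>X\<close> only,
    so they carry over to every other probability space.\<close>
  have improve: "\<exists>K. ?lin K \<and> ereal (?L 0 K) \<le> quad_cost P x (W 0) \<mu>"
    if "centered_gaussian P x X" and adm: "\<mu> \<in> admissible P x bx bu M W \<gamma>"
      and fin: "quad_cost P x (W 0) \<mu> < \<infinity>"
    for P :: "'a measure" and x \<mu>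
  proof -
    interpret centered_gaussian P x X by fact
    have \<mu>: "\<mu> \<in> decisions bx bu" using adm by (simp add: admissible_def)
    have sq: "square_integrable P (\<lambda>\<omega>. \<mu> (x \<omega>) $ k)" for k
      using square_integrable_if_quad_cost_finite[OF psd assms(5) \<mu>] fin by (simp add: W)
    from decision_linear_projection[OF \<mu> sq] obtain K where K: "K \<in> ?B"
      "\<And>k l. (\<integral>\<omega>. (\<mu> (x \<omega>) - K *v x \<omega>) $ k * x \<omega> $ l \<partial>P) = 0" by blast
    have le: "ereal (?L j K) \<le> quad_cost P x (W j) \<mu>" if "j = 0 \<or> j \<in> {1..M}" for j
      unfolding W by (rule quad_cost_linear_le[OF Rpsd[OF that] sq K(2)])
    have "?L j K \<le> \<gamma> j" if "j \<in> {1..M}" for j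
    proof -
      have "ereal (?L j K) \<le> quad_cost P x (W j) \<mu>" using le that by blast
      also have "\<dots> \<le> ereal (\<gamma> j)" using adm that by (auto simp: admissible_def)
      finally show ?thesis by simp
    qed
    then show ?thesis using K(1) le by blast
  qed
  show ?thesis
  proof (cases "\<exists>(P :: 'a measure) x. centered_gaussian P x X \<and> feasible P x bx bu M W \<gamma>")
    \<comment> \<open>No instance is feasible, so the claim is vacuous for any block-diagonal
      matrix.\<close>
    case False
    then show ?thesis
      using subspace_0[OF subspace_block_diag, of bx bu]
      by (intro bexI[of _ 0]) (auto simp: centered_gaussian_def centered_gaussian_axioms_def)
  next
    case True
    then obtain P0 :: "'a measure" and x0 where P0: "centered_gaussian P0 x0 X" "feasible P0 x0 bx bu M W \<gamma>"
      by blast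
    then obtain \<mu> where "\<mu> \<in> admissible P0 x0 bx bu M W \<gamma>" "quad_cost P0 x0 (W 0) \<mu> < \<infinity>"
      by (auto simp: feasible_def)
    \<comment> \<open>One feasible instance suffices: it supplies a linear starting point
      \<open>K0\<close> and a space on which to carry out the minimization, whose result again
      refers to \<open>X\<close> only.\<close>
    from improve[OF P0(1) this] obtain K0 where K0: "K0 \<in> ?B" "\<And>j. j \<in> {1..M} \<Longrightarrow> ?L j K0 \<le> \<gamma> j" by blast
    interpret P0: centered_gaussian P0 x0 X by (rule P0)
    from P0.linear_cost_attains_min[where Q = Q and S = S and R = R and \<gamma> = \<gamma>, OF assms(5) K0(1), of "{1..M}"] K0(2)
    obtain K where K: "?lin K"
      and min: "\<forall>K'\<in>?B. (\<forall>j\<in>{1..M}. ?L j K' \<le> \<gamma> j) \<longrightarrow> ?L 0 K \<le> ?L 0 K'"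
      by blast
    have "optimal P x bx bu M W \<gamma> (\<lambda>\<xi>. K *v \<xi>)" if "centered_gaussian P x X" for P :: "'a measure" and x
    proof -
      interpret centered_gaussian P x X by fact
      have cost: "quad_cost P x (W j) (\<lambda>\<xi>. K *v \<xi>) = ereal (?L j K)" for j
        unfolding W by (rule quad_cost_linear)
      have "(\<lambda>\<xi>. K *v \<xi>) \<in> admissible P x bx bu M W \<gamma>"
        using K block_diag_decision[of K bx bu] by (simp add: admissible_def cost)
      moreover have "\<not> quad_cost P x (W 0) \<mu> < ereal (?L 0 K)" if "\<mu> \<in> admissible P x bx bu M W \<gamma>" for \<mu>
      proof
        assume less: "quad_cost P x (W 0) \<mu> < ereal (?L 0 K)"
        \<comment> \<open>A strictly better competitor cannot have infinite objective, so it can be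
          replaced by a linear one, which the choice of \<open>K\<close> already beats or
          equals.\<close>
        then have "quad_cost P x (W 0) \<mu> < \<infinity>" by (rule less_trans) simp
        from improve[OF \<open>centered_gaussian P x X\<close> that this] obtain K' where
          "?lin K'" "ereal (?L 0 K') \<le> quad_cost P x (W 0) \<mu>" by blast
        moreover from this(1) min have "ereal (?L 0 K) \<le> ereal (?L 0 K')" by simp
        ultimately show False using less by (meson leD order_trans)
      qed
      ultimately show ?thesis by (simp add: optimal_def is_arg_min_def cost)
    qed
    then show ?thesis
      using K by (intro bexI[of _ K]) (auto simp: centered_gaussian_def centered_gaussian_axioms_def)
  qed
qed

end
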